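(* Let $A$ be a local ring with maximal ideal $\mathfrak{m}$, $M$ a finitely generated $A$-module, $\mathfrak{a}$ an ideal of $A$, and let $a_1,\ldots,a_r\in\mathfrak{m}$ be an $\mathfrak{a}$-filter-regular $M$-sequence whose elements lie in $\mathfrak{a}$. Then for each integer $n\ge 0$ there exists an ascending sequence of integers $n\le n_1\le\cdots\le n_r$ such that $a_1^{n_1},\ldots,a_r^{n_r}$ is an absolutely superficial $M$-sequence.
   Context: Local rings are commutative and Noetherian. For $a_1,\ldots,a_r\in\mathfrak{m}$ put $\mathfrak{q}_i=(a_1,\ldots,a_i)$, $\mathfrak{q}_0=0$, $\mathfrak{q}=\mathfrak{q}_r$. For a submodule $N$ of a module $L$ and $a\in A$, $N:a=\{x\in L: ax\in N\}$. $V(\mathfrak{a})$ is the set of prime ideals of $A$ containing $\mathfrak{a}$. The sequence $a_1,\ldots,a_r$ is an $\mathfrak{a}$-filter-regular $M$-sequence if $a_i\notin\mathfrak{p}$ for all $\mathfrak{p}\in\mathrm{Ass}(M/\mathfrak{q}_{i-1}M)\setminus V(\mathfrak{a})$, $i=1,\ldots,r$. The sequence $a_1,\ldots,a_r$ is an absolutely superficial $M$-sequence if for each $i=1,\ldots,r$, with $M_{i-1}:=M/\mathfrak{q}_{i-1}M$, one has $(\mathfrak{q}^{n+1}M_{i-1}:a_i)\cap\mathfrak{q}M_{i-1}=\mathfrak{q}^nM_{i-1}$ for all sufficiently large $n$. (For the sequence of powers $a_1^{n_1},\ldots,a_r^{n_r}$ the ideals $\mathfrak{q}_i,\mathfrak{q}$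 are formed from these powers.) *)

theory Defs
  imports "HOL-Algebra.Algebra"
begin

text \<open>Local rings are commutative and Noetherian throughout.\<close>

locale local_ring = cring A + noetherian_ring A for A (structure) and \<mm> +
  assumes maximal: "maximalideal \<mm> A"
    and unique_maximal: "maximalideal \<nn> A \<Longrightarrow> \<nn> = \<mm>"

definition submodule_gen ::
    "('a, 'k) ring_scheme \<Rightarrow> ('a, 'b, 'l) module_scheme \<Rightarrow> 'b set \<Rightarrow> 'b set"
  where "submodule_gen A L S = \<Inter>{N. submodule N A L \<and> S \<subseteq> N}"

definition finitely_generated ::
    "('a, 'k) ring_scheme \<Rightarrow> ('a, 'b, 'l) module_scheme \<Rightarrow> bool"
  where "finitely_generated A L \<longleftrightarrow>
    (\<exists>S. finite S \<and> S \<subseteq> carrier L \<and> submodule_gen A L S = carrier L)"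

text \<open>The submodule \<open>IL\<close> of a module \<open>L\<close>, for an ideal \<open>I\<close>.\<close>

definition ideal_smult ::
    "('a, 'k) ring_scheme \<Rightarrow> 'a set \<Rightarrow> ('a, 'b, 'l) module_scheme \<Rightarrow> 'b set"
  where "ideal_smult A I L = submodule_gen A L {c \<odot>\<^bsub>L\<^esub> x | c x. c \<in> I \<and> x \<in> carrier L}"

text \<open>The quotient \<open>L/N\<close>, whose elements are the cosets of \<open>N\<close>.  Module records inherit the
  fields \<^const>\<open>monoid.mult\<close> and \<^const>\<open>one\<close> from rings; they play no role for modules and are
  left unspecified.\<close>

definition quot_module :: "('a, 'b, 'l) module_scheme \<Rightarrow> 'b set \<Rightarrow> ('a, 'b set) module"
  where "quot_module L N =
    \<lparr>carrier = a_rcosets\<^bsub>L\<^esub> N, monoid.mult = undefined, one = undefined, ring.zero = N, ring.add = set_add L,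
     smult = (\<lambda>c C. \<Union>x\<in>C. N +>\<^bsub>L\<^esub> (c \<odot>\<^bsub>L\<^esub> x))\<rparr>"

lemma quot_module_smult:
  assumes M: "module A M" and N: "submodule N A M" and c: "c \<in> carrier A" and x: "x \<in> carrier M"
  shows "c \<odot>\<^bsub>quot_module M N\<^esub> (N +>\<^bsub>M\<^esub> x) = N +>\<^bsub>M\<^esub> (c \<odot>\<^bsub>M\<^esub> x)"
proof -
  interpret M: module A M by fact
  interpret N: submodule N A M by fact
  interpret ag: abelian_subgroup N M
    by (rule abelian_subgroupI3) (auto simp: additive_subgroup_def N.subgroup_axioms M.abelian_group_axioms)
  have sub: "N \<subseteq> carrier M" using ag.a_subset .
  have "N +>\<^bsub>M\<^esub> (c \<odot>\<^bsub>M\<^esub> y) = N +>\<^bsub>M\<^esub> (c \<odot>\<^bsub>M\<^esub> x)" if y: "y \<in> N +>\<^bsub>M\<^esub> x" for y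
  proof -
    from y obtain h where h: "h \<in> N" "y = h \<oplus>\<^bsub>M\<^esub> x" by (auto simp: a_r_coset_def')
    have "c \<odot>\<^bsub>M\<^esub> y = c \<odot>\<^bsub>M\<^esub> h \<oplus>\<^bsub>M\<^esub> c \<odot>\<^bsub>M\<^esub> x" using h(1) sub x c unfolding h(2) by (intro M.smult_r_distr) blast+
    then have "c \<odot>\<^bsub>M\<^esub> y \<in> N +>\<^bsub>M\<^esub> (c \<odot>\<^bsub>M\<^esub> x)"
      using N.smult_closed[OF c h(1)] by (auto simp: a_r_coset_def')
    then show ?thesis using ag.a_repr_independence'[OF _ M.smult_closed[OF c x]] by metis
  qed
  moreover have "x \<in> N +>\<^bsub>M\<^esub> x" using x by (rule ag.a_rcos_self)
  ultimately have "(\<Union>y\<in>N +>\<^bsub>M\<^esub> x. N +>\<^bsub>M\<^esub> (c \<odot>\<^bsub>M\<^esub> y)) = N +>\<^bsub>M\<^esub> (c \<odot>\<^bsub>M\<^esub> x)" by blast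
  then show ?thesis unfolding quot_module_def by (simp only: module.simps)
qed

lemma quot_module_is_module:
  assumes M: "module A M" and N: "submodule N A M"
  shows "module A (quot_module M N)" (is "module A ?Q")
proof -
  interpret M: module A M by fact
  interpret N: submodule N A M by fact
  interpret ag: abelian_subgroup N M
    by (rule abelian_subgroupI3) (auto simp: additive_subgroup_def N.subgroup_axioms M.abelian_group_axioms)
  have car: "carrier (quot_module M N) = a_rcosets\<^bsub>M\<^esub> N" by (simp add: quot_module_def)
  have repr: "\<exists>x\<in>carrier M. C = N +>\<^bsub>M\<^esub> x" if "C \<in> carrier (quot_module M N)" for C
    using that unfolding car A_RCOSETS_def' by blast
  have inc: "N +>\<^bsub>M\<^esub> x \<in> carrier (quot_module M N)" if "x \<in> carrier M" for x
    using that unfolding car A_RCOSETS_def' by blast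
  have add: "(N +>\<^bsub>M\<^esub> x) \<oplus>\<^bsub>quot_module M N\<^esub> (N +>\<^bsub>M\<^esub> y) = N +>\<^bsub>M\<^esub> (x \<oplus>\<^bsub>M\<^esub> y)"
    if "x \<in> carrier M" "y \<in> carrier M" for x y
    using ag.a_rcos_sum[OF that] by (simp add: quot_module_def)
  have sm: "c \<odot>\<^bsub>quot_module M N\<^esub> (N +>\<^bsub>M\<^esub> x) = N +>\<^bsub>M\<^esub> (c \<odot>\<^bsub>M\<^esub> x)"
    if "c \<in> carrier A" "x \<in> carrier M" for c x using quot_module_smult[OF M N that] .
  have z: "\<zero>\<^bsub>quot_module M N\<^esub> = N +>\<^bsub>M\<^esub> \<zero>\<^bsub>M\<^esub>"
    using M.a_coset_add_zero[OF ag.a_subset] by (simp add: quot_module_def)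
  show ?thesis
  proof (rule moduleI)
    show "cring A" by (rule M.R.is_cring)
    show "abelian_group (quot_module M N)"
    proof (rule abelian_groupI)
      fix x assume "x \<in> carrier (quot_module M N)"
      then obtain y where y: "y \<in> carrier M" "x = N +>\<^bsub>M\<^esub> y" using repr by blast
      show "\<exists>w\<in>carrier (quot_module M N). w \<oplus>\<^bsub>quot_module M N\<^esub> x = \<zero>\<^bsub>quot_module M N\<^esub>"
        by (rule bexI[of _ "N +>\<^bsub>M\<^esub> (\<ominus>\<^bsub>M\<^esub> y)"]) (use y in \<open>auto simp: add z inc M.l_neg\<close>)
    next
      fix x y w assume "x \<in> carrier ?Q" "y \<in> carrier ?Q" "w \<in> carrier ?Q"
      then obtain x' y' w' where [simp]: "x' \<in> carrier M" "y' \<in> carrier M" "w' \<in> carrier M"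
        and e: "x = N +>\<^bsub>M\<^esub> x'" "y = N +>\<^bsub>M\<^esub> y'" "w = N +>\<^bsub>M\<^esub> w'" by (meson repr)
      show "x \<oplus>\<^bsub>?Q\<^esub> y \<oplus>\<^bsub>?Q\<^esub> w = x \<oplus>\<^bsub>?Q\<^esub> (y \<oplus>\<^bsub>?Q\<^esub> w)" unfolding e by (simp add: add M.a_assoc)
    next
      fix x y assume "x \<in> carrier ?Q" "y \<in> carrier ?Q"
      then obtain x' y' where [simp]: "x' \<in> carrier M" "y' \<in> carrier M"
        and e: "x = N +>\<^bsub>M\<^esub> x'" "y = N +>\<^bsub>M\<^esub> y'" by (meson repr)
      show "x \<oplus>\<^bsub>?Q\<^esub> y = y \<oplus>\<^bsub>?Q\<^esub> x" unfolding e by (simp add: add M.a_comm)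
      show "x \<oplus>\<^bsub>?Q\<^esub> y \<in> carrier ?Q" unfolding e by (simp add: add inc)
      show "\<zero>\<^bsub>?Q\<^esub> \<oplus>\<^bsub>?Q\<^esub> x = x" unfolding e z by (simp add: add)
    next
      show "\<zero>\<^bsub>?Q\<^esub> \<in> carrier ?Q" unfolding z by (simp add: inc)
    qed
  next
    fix a b x y assume [simp]: "a \<in> carrier A" "b \<in> carrier A" and "x \<in> carrier ?Q" "y \<in> carrier ?Q"
    then obtain x' y' where [simp]: "x' \<in> carrier M" "y' \<in> carrier M"
        and e: "x = N +>\<^bsub>M\<^esub> x'" "y = N +>\<^bsub>M\<^esub> y'" by (meson repr)
    show "a \<odot>\<^bsub>?Q\<^esub> (x \<oplus>\<^bsub>?Q\<^esub> y) = a \<odot>\<^bsub>?Q\<^esub> x \<oplus>\<^bsub>?Q\<^esub> a \<odot>\<^bsub>?Q\<^esub> y" unfolding e by (simp add: add sm M.smult_r_distr)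
  next
    fix a b x assume [simp]: "a \<in> carrier A" "b \<in> carrier A" and "x \<in> carrier ?Q"
    then obtain x' where [simp]: "x' \<in> carrier M"
        and e: "x = N +>\<^bsub>M\<^esub> x'" by (meson repr)
    show "a \<odot>\<^bsub>?Q\<^esub> x \<in> carrier ?Q" unfolding e by (simp add: sm inc)
    show "(a \<oplus>\<^bsub>A\<^esub> b) \<odot>\<^bsub>?Q\<^esub> x = a \<odot>\<^bsub>?Q\<^esub> x \<oplus>\<^bsub>?Q\<^esub> b \<odot>\<^bsub>?Q\<^esub> x" unfolding e by (simp add: sm add M.smult_l_distr)
    show "(a \<otimes>\<^bsub>A\<^esub> b) \<odot>\<^bsub>?Q\<^esub> x = a \<odot>\<^bsub>?Q\<^esub> (b \<odot>\<^bsub>?Q\<^esub> x)" unfolding e by (simp add: sm M.smult_assoc1)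
  next
    fix x assume "x \<in> carrier ?Q"
    then obtain x' where [simp]: "x' \<in> carrier M"
        and e: "x = N +>\<^bsub>M\<^esub> x'" by (meson repr)
    show "\<one>\<^bsub>A\<^esub> \<odot>\<^bsub>?Q\<^esub> x = x" unfolding e by (simp add: sm)
  qed
qed

text \<open>The colon submodule \<open>N : c\<close> in \<open>L\<close>.\<close>

definition colon :: "('a, 'b, 'l) module_scheme \<Rightarrow> 'b set \<Rightarrow> 'a \<Rightarrow> 'b set"
  where "colon L N c = {x \<in> carrier L. c \<odot>\<^bsub>L\<^esub> x \<in> N}"

definition annihilator ::
    "('a, 'k) ring_scheme \<Rightarrow> ('a, 'b, 'l) module_scheme \<Rightarrow> 'b \<Rightarrow> 'a set"
  where "annihilator A L x = {c \<in> carrier A. c \<odot>\<^bsub>L\<^esub> x = \<zero>\<^bsub>L\<^esub>}"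

definition Ass :: "('a, 'k) ring_scheme \<Rightarrow> ('a, 'b, 'l) module_scheme \<Rightarrow> 'a set set"
  where "Ass A L = {\<pp>. primeideal \<pp> A \<and> (\<exists>x\<in>carrier L. \<pp> = annihilator A L x)}"

definition V :: "('a, 'k) ring_scheme \<Rightarrow> 'a set \<Rightarrow> 'a set set"
  where "V A \<aa> = {\<pp>. primeideal \<pp> A \<and> \<aa> \<subseteq> \<pp>}"


text \<open>A sequence \<open>a\<^sub>1, \<dots>, a\<^sub>r\<close> is a function on \<^typ>\<open>nat\<close> of which only the values at \<open>1, \<dots>, r\<close>
  matter.  The ideal \<open>\<qq>\<^sub>i = (a\<^sub>1, \<dots>, a\<^sub>i)\<close> is \<open>seq_ideal A a i\<close>, and \<open>M/\<qq>\<^sub>iM\<close> is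
  \<open>seq_quot A M a i\<close>.\<close>

definition seq_ideal :: "('a, 'k) ring_scheme \<Rightarrow> (nat \<Rightarrow> 'a) \<Rightarrow> nat \<Rightarrow> 'a set"
  where "seq_ideal A a i = Idl\<^bsub>A\<^esub> (a ` {1..i})"

definition seq_quot ::
    "('a, 'k) ring_scheme \<Rightarrow> ('a, 'b, 'l) module_scheme \<Rightarrow> (nat \<Rightarrow> 'a) \<Rightarrow> nat \<Rightarrow> ('a, 'b set) module"
  where "seq_quot A M a i = quot_module M (ideal_smult A (seq_ideal A a i) M)"

text \<open>Both notions below are only considered for sequences in the maximal ideal \<open>\<mm>\<close>, which is
  therefore made part of the definitions.\<close>

definition filter_regular_seq ::
    "('a, 'k) ring_scheme \<Rightarrow> 'a set \<Rightarrow> 'a set \<Rightarrow> ('a, 'b, 'l) module_scheme \<Rightarrow> (nat \<Rightarrow> 'a) \<Rightarrow> nat \<Rightarrow> bool"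
  where "filter_regular_seq A \<mm> \<aa> M a r \<longleftrightarrow>
    (\<forall>i\<in>{1..r}. a i \<in> \<mm>) \<and>
    (\<forall>i\<in>{1..r}. \<forall>\<pp> \<in> Ass A (seq_quot A M a (i - 1)) - V A \<aa>. a i \<notin> \<pp>)"

text \<open>The powers of the ideal \<open>\<qq>\<close> are its powers in the monoid \<^term>\<open>ideals_set A\<close> of ideals of
  \<open>A\<close>.\<close>

definition absolutely_superficial_seq ::
    "('a, 'k) ring_scheme \<Rightarrow> 'a set \<Rightarrow> ('a, 'b, 'l) module_scheme \<Rightarrow> (nat \<Rightarrow> 'a) \<Rightarrow> nat \<Rightarrow> bool"
  where "absolutely_superficial_seq A \<mm> M a r \<longleftrightarrow>
    (\<forall>i\<in>{1..r}. a i \<in> \<mm>) \<and>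
    (\<forall>i\<in>{1..r}. let \<qq> = seq_ideal A a r; L = seq_quot A M a (i - 1) in
      \<forall>\<^sub>F n :: nat in sequentially.
        colon L (ideal_smult A (\<qq> [^]\<^bsub>ideals_set A\<^esub> (n + 1)) L) (a i) \<inter> ideal_smult A \<qq> L
          = ideal_smult A (\<qq> [^]\<^bsub>ideals_set A\<^esub> n) L)"

end

theory Submission
  imports Defs
begin

text \<open>For \<open>a \<in> \<aa>\<close> avoiding the associated primes of \<open>M/N\<close> outside \<open>V(\<aa>)\<close> one has
  \<open>N : a \<subseteq> N : \<aa>\<^sup>\<infinity>\<close>, and in this form filter-regularity passes to powers of the elements.  A submodule
  \<open>W \<supseteq> N\<close> maximal with \<open>W \<inter> (N : \<aa>\<^sup>\<infinity>) = N\<close> contains \<open>b\<^sup>kM\<close> for every \<open>b \<in> \<aa>\<close> and large \<open>k\<close>.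
  Choosing the exponents one after the other, each beyond the bound coming from \<open>N = \<qq>\<^sub>i\<^sub>-\<^sub>1M\<close>, one gets
  powers \<open>b\<^sub>i\<close> of the \<open>a\<^sub>i\<close> with \<open>(\<qq>\<^sub>i\<^sub>-\<^sub>1M : b\<^sub>i) \<inter> \<qq>M = \<qq>\<^sub>i\<^sub>-\<^sub>1M\<close>, where now
  \<open>\<qq>\<^sub>i = (b\<^sub>1, \<dots>, b\<^sub>i)\<close>.  This relative regularity implies
  \<open>\<qq>\<^sub>iM \<inter> \<qq>\<^sup>n\<^sup>+\<^sup>1M = \<qq>\<^sub>i\<qq>\<^sup>nM\<close> by induction on \<open>n\<close> and descending induction on \<open>i\<close>, from which
  absolute superficiality follows for all \<open>n \<ge> 1\<close>.\<close>

section \<open>Saturation and filter-regularity\<close>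

context module
begin

section \<open>Element arithmetic in submodules\<close>

lemma submodule_carrier: "submodule N R M \<Longrightarrow> x \<in> N \<Longrightarrow> x \<in> carrier M"
  using submoduleE(1) by blast

lemma submodule_zero: "submodule N R M \<Longrightarrow> \<zero>\<^bsub>M\<^esub> \<in> N"
  using subgroup.one_closed[of N "add_monoid M"] by (simp add: submodule_def)

lemma submodule_add: "submodule N R M \<Longrightarrow> x \<in> N \<Longrightarrow> y \<in> N \<Longrightarrow> x \<oplus>\<^bsub>M\<^esub> y \<in> N"
  by (rule submoduleE(5))

lemma submodule_smult: "submodule N R M \<Longrightarrow> c \<in> carrier R \<Longrightarrow> x \<in> N \<Longrightarrow> c \<odot>\<^bsub>M\<^esub> x \<in> N"
  by (rule submoduleE(4))

lemma submodule_minus: "submodule N R M \<Longrightarrow> x \<in> N \<Longrightarrow> y \<in> N \<Longrightarrow> x \<ominus>\<^bsub>M\<^esub> y \<in> N"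
  unfolding a_minus_def by (rule submodule_add) (auto intro: submoduleE(3))

lemma submodule_minusD:
  assumes "submodule N R M" "x \<in> carrier M" "y \<in> N" "x \<ominus>\<^bsub>M\<^esub> y \<in> N"
  shows "x \<in> N"
proof -
  have "y \<in> carrier M" using assms(1,3) by (rule submodule_carrier)
  then have "x = (x \<ominus>\<^bsub>M\<^esub> y) \<oplus>\<^bsub>M\<^esub> y" using assms(2) by (simp add: a_minus_def M.a_assoc M.l_neg)
  then show ?thesis using submodule_add[OF assms(1,4,3)] by simp
qed

lemma minus_eq_iff:
  "x \<in> carrier M \<Longrightarrow> y \<in> carrier M \<Longrightarrow> z \<in> carrier M \<Longrightarrow> x \<ominus>\<^bsub>M\<^esub> y = z \<longleftrightarrow> x = z \<oplus>\<^bsub>M\<^esub> y"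
  by (metis M.add.inv_solve_right a_minus_def)

lemma minus_eq_minusI:
  assumes "x \<in> carrier M" "y \<in> carrier M" "z \<in> carrier M" "w \<in> carrier M"
    and "x \<oplus>\<^bsub>M\<^esub> y = z \<oplus>\<^bsub>M\<^esub> w"
  shows "y \<ominus>\<^bsub>M\<^esub> w = z \<ominus>\<^bsub>M\<^esub> x"
proof -
  have "y = (\<ominus>\<^bsub>M\<^esub> x) \<oplus>\<^bsub>M\<^esub> (x \<oplus>\<^bsub>M\<^esub> y)"
    using assms(1,2) by (simp add: M.a_assoc[symmetric] M.l_neg)
  also have "\<dots> = (z \<ominus>\<^bsub>M\<^esub> x) \<oplus>\<^bsub>M\<^esub> w"
    using assms by (simp add: a_minus_def M.a_ac)
  finally show ?thesis using assms(1-4) by (simp add: minus_eq_iff)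
qed

lemma smult_minus:
  "c \<in> carrier R \<Longrightarrow> x \<in> carrier M \<Longrightarrow> y \<in> carrier M \<Longrightarrow>
    c \<odot>\<^bsub>M\<^esub> (x \<ominus>\<^bsub>M\<^esub> y) = c \<odot>\<^bsub>M\<^esub> x \<ominus>\<^bsub>M\<^esub> c \<odot>\<^bsub>M\<^esub> y"
  by (simp add: a_minus_def smult_r_distr smult_r_minus)

lemma smult_left_commute:
  "c \<in> carrier R \<Longrightarrow> d \<in> carrier R \<Longrightarrow> x \<in> carrier M \<Longrightarrow>
    c \<odot>\<^bsub>M\<^esub> (d \<odot>\<^bsub>M\<^esub> x) = d \<odot>\<^bsub>M\<^esub> (c \<odot>\<^bsub>M\<^esub> x)"
  by (metis R.m_comm smult_assoc1)

lemma pow_smult_add: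
  "c \<in> carrier R \<Longrightarrow> x \<in> carrier M \<Longrightarrow>
    c [^] (k + l :: nat) \<odot>\<^bsub>M\<^esub> x = c [^] k \<odot>\<^bsub>M\<^esub> (c [^] l \<odot>\<^bsub>M\<^esub> x)"
  by (simp add: R.nat_pow_mult[symmetric] smult_assoc1)

lemma pow_smult_mono:
  assumes "submodule N R M" "c \<in> carrier R" "x \<in> carrier M" "c [^] (k::nat) \<odot>\<^bsub>M\<^esub> x \<in> N" "k \<le> l"
  shows "c [^] l \<odot>\<^bsub>M\<^esub> x \<in> N"
proof -
  have "c [^] l \<odot>\<^bsub>M\<^esub> x = c [^] (l - k) \<odot>\<^bsub>M\<^esub> (c [^] k \<odot>\<^bsub>M\<^esub> x)"
    using pow_smult_add[OF assms(2,3), of "l - k" k] assms(5) by simp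
  then show ?thesis using assms by (simp add: submodule_smult)
qed

lemma submodule_Int:
  "submodule N R M \<Longrightarrow> submodule N' R M \<Longrightarrow> submodule (N \<inter> N') R M"
  by (rule submoduleI) (auto intro: submodule_carrier submodule_zero submodule_add submodule_smult submoduleE(3))

lemma submodule_zero_set: "submodule {\<zero>\<^bsub>M\<^esub>} R M"
  by (rule submoduleI) auto

lemma colon_submodule:
  assumes "submodule N R M" "c \<in> carrier R"
  shows "submodule (colon M N c) R M"
  by (rule submoduleI)
    (use assms in \<open>auto simp: colon_def smult_r_distr smult_r_minus smult_left_commute[of c]
      intro: submodule_carrier submodule_zero submodule_add submodule_smult submoduleE(3)\<close>)

text \<open>This is N + bK. The set K is a parameter because two cases are needed: K = M gives the
  denominators of the quotients M/(N + bM), and K = q^n M gives the summands of q_i q^n M.\<close>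

definition adjoin :: "'c set \<Rightarrow> 'a \<Rightarrow> 'c set \<Rightarrow> 'c set"
  where "adjoin N b K = {u \<oplus>\<^bsub>M\<^esub> b \<odot>\<^bsub>M\<^esub> y | u y. u \<in> N \<and> y \<in> K}"

lemma adjoinI: "u \<in> N \<Longrightarrow> y \<in> K \<Longrightarrow> u \<oplus>\<^bsub>M\<^esub> b \<odot>\<^bsub>M\<^esub> y \<in> adjoin N b K"
  by (auto simp: adjoin_def)

lemma adjoinE:
  assumes "x \<in> adjoin N b K"
  obtains u y where "u \<in> N" "y \<in> K" "x = u \<oplus>\<^bsub>M\<^esub> b \<odot>\<^bsub>M\<^esub> y"
  using assms by (auto simp: adjoin_def)

lemma adjoin_submodule:
  assumes N: "submodule N R M" and K: "submodule K R M" and b: "b \<in> carrier R"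
  shows "submodule (adjoin N b K) R M"
proof (rule submoduleI)
  have [simp]: "u \<in> N \<Longrightarrow> u \<in> carrier M" "y \<in> K \<Longrightarrow> y \<in> carrier M" for u y
    using N K by (auto intro: submodule_carrier)
  show "adjoin N b K \<subseteq> carrier M" using b by (auto simp: adjoin_def)
  show "\<zero>\<^bsub>M\<^esub> \<in> adjoin N b K"
    using adjoinI[OF submodule_zero[OF N] submodule_zero[OF K], of b] b by simp
  fix x assume "x \<in> adjoin N b K"
  then obtain u y where x: "u \<in> N" "y \<in> K" "x = u \<oplus>\<^bsub>M\<^esub> b \<odot>\<^bsub>M\<^esub> y" by (rule adjoinE)
  have "\<ominus>\<^bsub>M\<^esub> x = (\<ominus>\<^bsub>M\<^esub> u) \<oplus>\<^bsub>M\<^esub> b \<odot>\<^bsub>M\<^esub> (\<ominus>\<^bsub>M\<^esub> y)"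
    using x b by (simp add: smult_r_minus M.minus_add)
  then show "\<ominus>\<^bsub>M\<^esub> x \<in> adjoin N b K"
    using submoduleE(3)[OF N x(1)] submoduleE(3)[OF K x(2)] adjoinI by metis
  { fix x' assume "x' \<in> adjoin N b K"
    then obtain u' y' where x': "u' \<in> N" "y' \<in> K" "x' = u' \<oplus>\<^bsub>M\<^esub> b \<odot>\<^bsub>M\<^esub> y'" by (rule adjoinE)
    have "x \<oplus>\<^bsub>M\<^esub> x' = (u \<oplus>\<^bsub>M\<^esub> u') \<oplus>\<^bsub>M\<^esub> b \<odot>\<^bsub>M\<^esub> (y \<oplus>\<^bsub>M\<^esub> y')"
      using x x' b by (simp add: smult_r_distr M.a_ac)
    then show "x \<oplus>\<^bsub>M\<^esub> x' \<in> adjoin N b K"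
      using submodule_add[OF N x(1) x'(1)] submodule_add[OF K x(2) x'(2)] adjoinI by metis }
  fix c assume c: "c \<in> carrier R"
  have "c \<odot>\<^bsub>M\<^esub> x = c \<odot>\<^bsub>M\<^esub> u \<oplus>\<^bsub>M\<^esub> b \<odot>\<^bsub>M\<^esub> (c \<odot>\<^bsub>M\<^esub> y)"
    using x b c by (simp add: smult_r_distr smult_left_commute)
  then show "c \<odot>\<^bsub>M\<^esub> x \<in> adjoin N b K"
    using submodule_smult[OF N c x(1)] submodule_smult[OF K c x(2)] adjoinI by metis
qed

lemma adjoin_upper:
  assumes "submodule N R M" "submodule K R M" "b \<in> carrier R"
  shows "N \<subseteq> adjoin N b K"
proof
  fix x assume "x \<in> N"
  then show "x \<in> adjoin N b K"
    using adjoinI[OF _ submodule_zero[OF assms(2)], of x N b] submodule_carrier[OF assms(1), of x] assms(3) by simp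
qed

lemma smult_in_adjoin:
  assumes "submodule N R M" "submodule K R M" "b \<in> carrier R" "y \<in> K"
  shows "b \<odot>\<^bsub>M\<^esub> y \<in> adjoin N b K"
  using adjoinI[OF submodule_zero[OF assms(1)] assms(4), of b] assms by (auto dest: submodule_carrier)

lemma adjoin_least:
  assumes "submodule W R M" "N \<subseteq> W" "\<And>y. y \<in> K \<Longrightarrow> b \<odot>\<^bsub>M\<^esub> y \<in> W"
  shows "adjoin N b K \<subseteq> W"
  using assms by (auto simp: adjoin_def intro!: submodule_add)

lemma adjoin_mono: "N \<subseteq> N' \<Longrightarrow> K \<subseteq> K' \<Longrightarrow> adjoin N b K \<subseteq> adjoin N' b K'"
  by (auto simp: adjoin_def)

section \<open>Saturation with respect to an ideal\<close>

text \<open>With \<open>I\<close> finitely generated this is the usual saturation \<open>\<Union>\<^sub>t N : I\<^sup>t\<close>.\<close>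

definition saturation :: "'a set \<Rightarrow> 'c set \<Rightarrow> 'c set"
  where "saturation I N = {x \<in> carrier M. \<forall>b\<in>I. \<exists>k::nat. b [^] k \<odot>\<^bsub>M\<^esub> x \<in> N}"

lemma saturationD: "x \<in> saturation I N \<Longrightarrow> x \<in> carrier M"
  by (simp add: saturation_def)

lemma saturation_le:
  assumes "submodule N R M" "I \<subseteq> carrier R"
  shows "N \<subseteq> saturation I N"
proof
  fix x assume x: "x \<in> N"
  have "x \<in> carrier M" using assms(1) x by (rule submodule_carrier)
  moreover from this have "b [^] (0::nat) \<odot>\<^bsub>M\<^esub> x \<in> N" for b using x by simp
  ultimately show "x \<in> saturation I N" unfolding saturation_def by blast
qed

text \<open>Exponents add: b^l (b^k x) = b^(l+k) x. As k may vary with b, membership of x can be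
  checked for one \<open>b\<close> at a time, after multiplying by a convenient power.\<close>

lemma saturation_idem:
  assumes N: "submodule N R M" and I: "I \<subseteq> carrier R" and x: "x \<in> carrier M"
    and *: "\<And>b. b \<in> I \<Longrightarrow> \<exists>k::nat. b [^] k \<odot>\<^bsub>M\<^esub> x \<in> saturation I N"
  shows "x \<in> saturation I N"
  unfolding saturation_def
proof (intro CollectI conjI ballI x)
  fix b assume b: "b \<in> I"
  then obtain k :: nat where "b [^] k \<odot>\<^bsub>M\<^esub> x \<in> saturation I N" using * by blast
  then obtain l :: nat where "b [^] l \<odot>\<^bsub>M\<^esub> (b [^] k \<odot>\<^bsub>M\<^esub> x) \<in> N" using b by (auto simp: saturation_def)
  then have "b [^] (l + k) \<odot>\<^bsub>M\<^esub> x \<in> N" using b I x by (subst pow_smult_add) auto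
  then show "\<exists>k::nat. b [^] k \<odot>\<^bsub>M\<^esub> x \<in> N" by blast
qed

lemma saturation_submodule:
  assumes N: "submodule N R M" and I: "I \<subseteq> carrier R"
  shows "submodule (saturation I N) R M"
proof (rule submoduleI)
  show "saturation I N \<subseteq> carrier M" by (auto simp: saturation_def)
  show "\<zero>\<^bsub>M\<^esub> \<in> saturation I N" using saturation_le[OF N I] submodule_zero[OF N] by blast
  fix x assume x: "x \<in> saturation I N"
  show "\<ominus>\<^bsub>M\<^esub> x \<in> saturation I N" unfolding saturation_def
  proof (intro CollectI conjI ballI)
    show "\<ominus>\<^bsub>M\<^esub> x \<in> carrier M" using saturationD[OF x] by simp
    fix b assume b: "b \<in> I"
    then obtain k :: nat where "b [^] k \<odot>\<^bsub>M\<^esub> x \<in> N" using x by (auto simp: saturation_def)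
    then have "b [^] k \<odot>\<^bsub>M\<^esub> (\<ominus>\<^bsub>M\<^esub> x) \<in> N"
      using b I saturationD[OF x] submoduleE(3)[OF N] by (subst smult_r_minus) auto
    then show "\<exists>k::nat. b [^] k \<odot>\<^bsub>M\<^esub> (\<ominus>\<^bsub>M\<^esub> x) \<in> N" by blast
  qed
  { fix y assume y: "y \<in> saturation I N"
    show "x \<oplus>\<^bsub>M\<^esub> y \<in> saturation I N" unfolding saturation_def
    proof (intro CollectI conjI ballI)
      show "x \<oplus>\<^bsub>M\<^esub> y \<in> carrier M" using saturationD x y by blast
      fix b assume b: "b \<in> I"
      then obtain k l :: nat where k: "b [^] k \<odot>\<^bsub>M\<^esub> x \<in> N" "b [^] l \<odot>\<^bsub>M\<^esub> y \<in> N"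
        using x y by (fastforce simp: saturation_def)
      have "b \<in> carrier R" "x \<in> carrier M" "y \<in> carrier M" using b I saturationD x y by auto
      note car = this
      have "b [^] (max k l) \<odot>\<^bsub>M\<^esub> x \<in> N" "b [^] (max k l) \<odot>\<^bsub>M\<^esub> y \<in> N"
        using pow_smult_mono[OF N car(1,2) k(1)] pow_smult_mono[OF N car(1,3) k(2)] by auto
      then have "b [^] (max k l) \<odot>\<^bsub>M\<^esub> (x \<oplus>\<^bsub>M\<^esub> y) \<in> N"
        using car submodule_add[OF N] by (subst smult_r_distr) auto
      then show "\<exists>k::nat. b [^] k \<odot>\<^bsub>M\<^esub> (x \<oplus>\<^bsub>M\<^esub> y) \<in> N" by blast
    qed }
  fix c assume c: "c \<in> carrier R"
  show "c \<odot>\<^bsub>M\<^esub> x \<in> saturation I N" unfolding saturation_def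
  proof (intro CollectI conjI ballI)
    show "c \<odot>\<^bsub>M\<^esub> x \<in> carrier M" using c saturationD[OF x] by simp
    fix b assume b: "b \<in> I"
    then obtain k :: nat where "b [^] k \<odot>\<^bsub>M\<^esub> x \<in> N" using x by (auto simp: saturation_def)
    then have "b [^] k \<odot>\<^bsub>M\<^esub> (c \<odot>\<^bsub>M\<^esub> x) \<in> N"
      using b I c saturationD[OF x] submodule_smult[OF N c] by (subst smult_left_commute) auto
    then show "\<exists>k::nat. b [^] k \<odot>\<^bsub>M\<^esub> (c \<odot>\<^bsub>M\<^esub> x) \<in> N" by blast
  qed
qed

text \<open>Powers of b commute past \<open>a\<close>: from b^k a x in N it follows that b^k x is in
  N : a, hence in the saturation, which absorbs b^k. Thus \<open>a\<close> is a nonzerodivisor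
  modulo the saturation.\<close>

lemma colon_saturation:
  assumes N: "submodule N R M" and I: "I \<subseteq> carrier R" and a: "a \<in> carrier R"
    and reg: "colon M N a \<subseteq> saturation I N"
    and x: "x \<in> carrier M" "a \<odot>\<^bsub>M\<^esub> x \<in> saturation I N"
  shows "x \<in> saturation I N"
proof (rule saturation_idem[OF N I x(1)])
  fix b assume b: "b \<in> I"
  then obtain k :: nat where k: "b [^] k \<odot>\<^bsub>M\<^esub> (a \<odot>\<^bsub>M\<^esub> x) \<in> N" using x by (auto simp: saturation_def)
  have "a \<odot>\<^bsub>M\<^esub> (b [^] k \<odot>\<^bsub>M\<^esub> x) \<in> N" using k a b I x by (subst smult_left_commute) auto
  then have "b [^] k \<odot>\<^bsub>M\<^esub> x \<in> colon M N a" using b I x by (auto simp: colon_def)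
  then show "\<exists>k::nat. b [^] k \<odot>\<^bsub>M\<^esub> x \<in> saturation I N" using reg by blast
qed

text \<open>The factors of a^e are cancelled one at a time. Cancelling a factor leads into the
  saturation rather than into N, so the induction runs on the condition that a^e x is in
  \<open>saturation I N\<close>.\<close>

lemma colon_pow_le_saturation:
  assumes N: "submodule N R M" and I: "I \<subseteq> carrier R" and a: "a \<in> carrier R"
    and reg: "colon M N a \<subseteq> saturation I N"
  shows "colon M N (a [^] (e::nat)) \<subseteq> saturation I N"
proof -
  have "x \<in> saturation I N" if "x \<in> carrier M" "a [^] e \<odot>\<^bsub>M\<^esub> x \<in> saturation I N" for x
    using that
  proof (induction e arbitrary: x)
    case 0 then show ?case by simp
  next
    case (Suc e)
    have "a [^] e \<odot>\<^bsub>M\<^esub> (a \<odot>\<^bsub>M\<^esub> x) \<in> saturation I N"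
      using Suc.prems a by (simp add: smult_assoc1)
    then have "a \<odot>\<^bsub>M\<^esub> x \<in> saturation I N" using Suc.IH a Suc.prems(1) by simp
    then show ?case using colon_saturation[OF N I a reg Suc.prems(1)] by simp
  qed
  then show ?thesis using saturation_le[OF N I] by (auto simp: colon_def)
qed

text \<open>Half of an exchange of neighbours: \<open>a\<close> is still filter-regular when it
  comes after \<open>b\<close>. If a x = u + b y, then y is in (N + aM) : b, so c^k y = v + a m for
  some k. Substituting gives a (c^k x - b m) in N, so c^k x is the sum of an element of the
  saturation of N and one of bM.\<close>

lemma filter_regular_swap:
  assumes N: "submodule N R M" and I: "I \<subseteq> carrier R" and a: "a \<in> carrier R" and b: "b \<in> carrier R"
    and rega: "colon M N a \<subseteq> saturation I N"
    and regb: "colon M (adjoin N a (carrier M)) b \<subseteq> saturation I (adjoin N a (carrier M))"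
  shows "colon M (adjoin N b (carrier M)) a \<subseteq> saturation I (adjoin N b (carrier M))"
proof
  let ?b = "adjoin N b (carrier M)"
  note C = carrier_is_submodule
  note sb = adjoin_submodule[OF N C b]
  fix x assume "x \<in> colon M ?b a"
  then have x: "x \<in> carrier M" "a \<odot>\<^bsub>M\<^esub> x \<in> ?b" by (auto simp: colon_def)
  then obtain u y where u: "u \<in> N" "y \<in> carrier M" and eq: "a \<odot>\<^bsub>M\<^esub> x = u \<oplus>\<^bsub>M\<^esub> b \<odot>\<^bsub>M\<^esub> y"
    by (auto elim: adjoinE)
  have [simp]: "v \<in> N \<Longrightarrow> v \<in> carrier M" for v using N by (rule submodule_carrier)
  note [simp] = a b x(1) u
  have "b \<odot>\<^bsub>M\<^esub> y = (\<ominus>\<^bsub>M\<^esub> u) \<oplus>\<^bsub>M\<^esub> a \<odot>\<^bsub>M\<^esub> x"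
    unfolding eq by (simp add: M.a_assoc[symmetric] M.l_neg)
  then have "b \<odot>\<^bsub>M\<^esub> y \<in> adjoin N a (carrier M)" using adjoinI submoduleE(3)[OF N u(1)] x(1) by metis
  then have y: "y \<in> saturation I (adjoin N a (carrier M))" using regb by (auto simp: colon_def)
  show "x \<in> saturation I ?b"
  proof (rule saturation_idem[OF sb I x(1)])
    fix c assume c: "c \<in> I"
    then have [simp]: "c \<in> carrier R" using I by blast
    obtain k :: nat where "c [^] k \<odot>\<^bsub>M\<^esub> y \<in> adjoin N a (carrier M)" using y c by (auto simp: saturation_def)
    then obtain v m where v[simp]: "v \<in> N" "m \<in> carrier M" and eq2: "c [^] k \<odot>\<^bsub>M\<^esub> y = v \<oplus>\<^bsub>M\<^esub> a \<odot>\<^bsub>M\<^esub> m"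
      by (auto elim: adjoinE)
    let ?z = "c [^] k \<odot>\<^bsub>M\<^esub> x \<ominus>\<^bsub>M\<^esub> b \<odot>\<^bsub>M\<^esub> m"
    have "a \<odot>\<^bsub>M\<^esub> (c [^] k \<odot>\<^bsub>M\<^esub> x) = c [^] k \<odot>\<^bsub>M\<^esub> u \<oplus>\<^bsub>M\<^esub> b \<odot>\<^bsub>M\<^esub> (c [^] k \<odot>\<^bsub>M\<^esub> y)"
      by (subst smult_left_commute) (simp_all add: eq smult_r_distr smult_left_commute)
    also have "\<dots> = (c [^] k \<odot>\<^bsub>M\<^esub> u \<oplus>\<^bsub>M\<^esub> b \<odot>\<^bsub>M\<^esub> v) \<oplus>\<^bsub>M\<^esub> a \<odot>\<^bsub>M\<^esub> (b \<odot>\<^bsub>M\<^esub> m)"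
      by (simp add: eq2 smult_r_distr M.a_assoc smult_left_commute)
    finally have "a \<odot>\<^bsub>M\<^esub> ?z = c [^] k \<odot>\<^bsub>M\<^esub> u \<oplus>\<^bsub>M\<^esub> b \<odot>\<^bsub>M\<^esub> v"
      by (simp add: smult_minus minus_eq_iff)
    also have "\<dots> \<in> N" by (intro submodule_add[OF N] submodule_smult[OF N]) auto
    finally have "?z \<in> saturation I N" using rega by (auto simp: colon_def)
    then have z: "?z \<in> saturation I ?b"
      using adjoin_upper[OF N C b] unfolding saturation_def by blast
    have "b \<odot>\<^bsub>M\<^esub> m \<in> saturation I ?b"
      using saturation_le[OF sb I] smult_in_adjoin[OF N C b v(2)] by blast
    then have "c [^] k \<odot>\<^bsub>M\<^esub> x \<in> saturation I ?b"
      using submodule_minusD[OF saturation_submodule[OF sb I] _ _ z] by simp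
    then show "\<exists>k::nat. c [^] k \<odot>\<^bsub>M\<^esub> x \<in> saturation I ?b" by blast
  qed
qed

text \<open>Induction on e. With b x = u + a^(e+1) y and c^k x = v + a m, cancelling one
  \<open>a\<close> shows that b m is in the saturation of N + a^e M, hence so is m by the induction
  hypothesis. Then c^l m = w + a^e t turns c^(l+k) x into an element of N + a^(e+1) M.\<close>

lemma filter_regular_pow_adjoin:
  assumes N: "submodule N R M" and I: "I \<subseteq> carrier R" and a: "a \<in> carrier R" and b: "b \<in> carrier R"
    and rega: "colon M N a \<subseteq> saturation I N"
    and regb: "colon M (adjoin N a (carrier M)) b \<subseteq> saturation I (adjoin N a (carrier M))"
  shows "colon M (adjoin N (a [^] (e::nat)) (carrier M)) b \<subseteq> saturation I (adjoin N (a [^] e) (carrier M))"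
proof (induction e)
  note C = carrier_is_submodule
  \<comment> \<open>The power is 1 here, and N + 1M is all of M.\<close>
  case 0
  have s: "submodule (adjoin N \<one> (carrier M)) R M" by (rule adjoin_submodule[OF N C]) simp
  have "x \<in> adjoin N \<one> (carrier M)" if "x \<in> carrier M" for x
    using smult_in_adjoin[OF N C R.one_closed that] that by simp
  then show ?case using saturation_le[OF s I] by (auto simp: colon_def)
next
  note C = carrier_is_submodule
  case (Suc e)
  let ?P = "\<lambda>e. adjoin N (a [^] (e::nat)) (carrier M)"
  have sP: "submodule (?P e) R M" for e using a by (intro adjoin_submodule[OF N C]) simp
  show ?case
  proof
    fix x assume "x \<in> colon M (?P (Suc e)) b"
    then have x: "x \<in> carrier M" "b \<odot>\<^bsub>M\<^esub> x \<in> ?P (Suc e)" by (auto simp: colon_def)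
    then obtain u y where u: "u \<in> N" "y \<in> carrier M" and eq: "b \<odot>\<^bsub>M\<^esub> x = u \<oplus>\<^bsub>M\<^esub> a [^] Suc e \<odot>\<^bsub>M\<^esub> y"
      by (auto elim: adjoinE)
    have [simp]: "v \<in> N \<Longrightarrow> v \<in> carrier M" for v using N by (rule submodule_carrier)
    note [simp] = a b x(1) u
    have pow: "a [^] Suc e \<odot>\<^bsub>M\<^esub> w = a \<odot>\<^bsub>M\<^esub> (a [^] e \<odot>\<^bsub>M\<^esub> w)" if "w \<in> carrier M" for w
      using that by (simp add: smult_assoc1 smult_left_commute)
    have "b \<odot>\<^bsub>M\<^esub> x \<in> adjoin N a (carrier M)" unfolding eq
      by (subst pow) (auto intro: adjoinI)
    then have xs: "x \<in> saturation I (adjoin N a (carrier M))" using regb by (auto simp: colon_def)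
    show "x \<in> saturation I (?P (Suc e))"
    proof (rule saturation_idem[OF sP I x(1)])
      fix c assume c: "c \<in> I"
      then have [simp]: "c \<in> carrier R" using I by blast
      obtain k :: nat where "c [^] k \<odot>\<^bsub>M\<^esub> x \<in> adjoin N a (carrier M)" using xs c by (auto simp: saturation_def)
      then obtain v m where v[simp]: "v \<in> N" "m \<in> carrier M" and eq2: "c [^] k \<odot>\<^bsub>M\<^esub> x = v \<oplus>\<^bsub>M\<^esub> a \<odot>\<^bsub>M\<^esub> m"
        by (auto elim: adjoinE)
      let ?y = "a [^] e \<odot>\<^bsub>M\<^esub> (c [^] k \<odot>\<^bsub>M\<^esub> y)"
      let ?z = "b \<odot>\<^bsub>M\<^esub> m \<ominus>\<^bsub>M\<^esub> ?y"
      have "b \<odot>\<^bsub>M\<^esub> v \<oplus>\<^bsub>M\<^esub> a \<odot>\<^bsub>M\<^esub> (b \<odot>\<^bsub>M\<^esub> m) = b \<odot>\<^bsub>M\<^esub> (c [^] k \<odot>\<^bsub>M\<^esub> x)"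
        by (simp add: eq2 smult_r_distr smult_left_commute)
      also have "\<dots> = c [^] k \<odot>\<^bsub>M\<^esub> (b \<odot>\<^bsub>M\<^esub> x)" by (simp add: smult_left_commute)
      also have "\<dots> = c [^] k \<odot>\<^bsub>M\<^esub> u \<oplus>\<^bsub>M\<^esub> a \<odot>\<^bsub>M\<^esub> ?y"
        unfolding eq by (simp add: smult_r_distr smult_assoc1 smult_left_commute)
      finally have "a \<odot>\<^bsub>M\<^esub> ?z = c [^] k \<odot>\<^bsub>M\<^esub> u \<ominus>\<^bsub>M\<^esub> b \<odot>\<^bsub>M\<^esub> v"
        by (simp add: smult_minus minus_eq_minusI)
      also have "\<dots> \<in> N" by (intro submodule_minus[OF N] submodule_smult[OF N]) auto
      finally have "?z \<in> saturation I N" using rega by (auto simp: colon_def)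
      then have z: "?z \<in> saturation I (?P e)"
        using adjoin_upper[OF N C, of "a [^] e"] unfolding saturation_def by auto
      have "?y \<in> saturation I (?P e)"
        using saturation_le[OF sP I] smult_in_adjoin[OF N C, of "a [^] e" "c [^] k \<odot>\<^bsub>M\<^esub> y"] by auto
      then have "b \<odot>\<^bsub>M\<^esub> m \<in> saturation I (?P e)"
        using submodule_minusD[OF saturation_submodule[OF sP I] _ _ z] by simp
      then have "m \<in> saturation I (?P e)" using colon_saturation[OF sP I b Suc.IH] by simp
      then obtain l :: nat where "c [^] l \<odot>\<^bsub>M\<^esub> m \<in> ?P e" using c by (auto simp: saturation_def)
      then obtain w t where w[simp]: "w \<in> N" "t \<in> carrier M" and eq3: "c [^] l \<odot>\<^bsub>M\<^esub> m = w \<oplus>\<^bsub>M\<^esub> a [^] e \<odot>\<^bsub>M\<^esub> t"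
        by (auto elim: adjoinE)
      have "c [^] (l + k) \<odot>\<^bsub>M\<^esub> x = c [^] l \<odot>\<^bsub>M\<^esub> v \<oplus>\<^bsub>M\<^esub> a \<odot>\<^bsub>M\<^esub> (c [^] l \<odot>\<^bsub>M\<^esub> m)"
        by (simp add: pow_smult_add eq2 smult_r_distr smult_left_commute)
      also have "\<dots> = (c [^] l \<odot>\<^bsub>M\<^esub> v \<oplus>\<^bsub>M\<^esub> a \<odot>\<^bsub>M\<^esub> w) \<oplus>\<^bsub>M\<^esub> a [^] Suc e \<odot>\<^bsub>M\<^esub> t"
        unfolding eq3 by (simp add: smult_r_distr smult_assoc1 smult_left_commute M.a_assoc)
      also have "\<dots> \<in> ?P (Suc e)"
        by (intro adjoinI submodule_add[OF N] submodule_smult[OF N]) auto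
      finally show "\<exists>k::nat. c [^] k \<odot>\<^bsub>M\<^esub> x \<in> saturation I (?P (Suc e))"
        using saturation_le[OF sP I] by blast
    qed
  qed
qed

subsection \<open>Sequences\<close>

lemma adjoin_commute_subset:
  assumes N: "submodule N R M" and bc: "b \<in> carrier R" "c \<in> carrier R" and K: "submodule K R M"
  shows "adjoin (adjoin N b K) c K \<subseteq> adjoin (adjoin N c K) b K"
proof
  fix x assume "x \<in> adjoin (adjoin N b K) c K"
  then obtain u y z where u: "u \<in> N" "y \<in> K" "z \<in> K" and "x = (u \<oplus>\<^bsub>M\<^esub> b \<odot>\<^bsub>M\<^esub> y) \<oplus>\<^bsub>M\<^esub> c \<odot>\<^bsub>M\<^esub> z"
    by (auto simp: adjoin_def)
  then have "x = (u \<oplus>\<^bsub>M\<^esub> c \<odot>\<^bsub>M\<^esub> z) \<oplus>\<^bsub>M\<^esub> b \<odot>\<^bsub>M\<^esub> y"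
    using bc submodule_carrier[OF N u(1)] submodule_carrier[OF K u(2)] submodule_carrier[OF K u(3)]
    by (simp add: M.a_ac)
  then show "x \<in> adjoin (adjoin N c K) b K" using u by (auto intro!: adjoinI)
qed

text \<open>Consuming the list from the front replaces N by N + bM, so statements about sequences
  can be proved by list induction with \<open>N\<close> arbitrary.\<close>

primrec adjoin_list :: "'c set \<Rightarrow> 'a list \<Rightarrow> 'c set"
  where "adjoin_list N [] = N"
  | "adjoin_list N (b # bs) = adjoin_list (adjoin N b (carrier M)) bs"

lemma adjoin_list_append: "adjoin_list N (as @ bs) = adjoin_list (adjoin_list N as) bs"
  by (induction as arbitrary: N) auto

lemma adjoin_list_least:
  assumes "submodule W R M" "N \<subseteq> W" "\<And>b y. b \<in> set bs \<Longrightarrow> y \<in> carrier M \<Longrightarrow> b \<odot>\<^bsub>M\<^esub> y \<in> W"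
  shows "adjoin_list N bs \<subseteq> W"
  using assms(2,3)
proof (induction bs arbitrary: N)
  case (Cons b bs)
  have "adjoin N b (carrier M) \<subseteq> W" using Cons.prems by (intro adjoin_least[OF assms(1)]) auto
  then show ?case using Cons by simp
qed simp

text \<open>Associated primes are replaced by an inclusion that can be handled by elements. Working
  over a base submodule \<open>N\<close> instead of in M/N keeps the type of the module fixed along
  the list.\<close>

definition filter_regular_list :: "'a set \<Rightarrow> 'c set \<Rightarrow> 'a list \<Rightarrow> bool"
  where "filter_regular_list I N as \<longleftrightarrow>
    (\<forall>i<length as. colon M (adjoin_list N (take i as)) (as ! i) \<subseteq> saturation I (adjoin_list N (take i as)))"

text \<open>Here \<open>adjoin_list N bs\<close>, over the whole list, stands for qM. Only one
  inclusion is demanded; the opposite one is automatic when \<open>N\<close> is a submodule and the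
  entries lie in the ring.\<close>

definition relative_regular_list :: "'c set \<Rightarrow> 'a list \<Rightarrow> bool"
  where "relative_regular_list N bs \<longleftrightarrow>
    (\<forall>i<length bs. colon M (adjoin_list N (take i bs)) (bs ! i) \<inter> adjoin_list N bs \<subseteq> adjoin_list N (take i bs))"

lemma filter_regular_list_Nil [simp]: "filter_regular_list I N []"
  by (simp add: filter_regular_list_def)

lemma filter_regular_list_Cons [simp]:
  "filter_regular_list I N (a # as) \<longleftrightarrow>
    colon M N a \<subseteq> saturation I N \<and> filter_regular_list I (adjoin N a (carrier M)) as"
  unfolding filter_regular_list_def by (auto simp: All_less_Suc2)

lemma relative_regular_list_Nil [simp]: "relative_regular_list N []"
  by (simp add: relative_regular_list_def)

text \<open>The tail over N + bM is intersected with the same total submodule as the full list over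
  N. This is what permits exponents to be chosen from the front.\<close>

lemma relative_regular_list_Cons [simp]:
  "relative_regular_list N (b # bs) \<longleftrightarrow>
    colon M N b \<inter> adjoin_list N (b # bs) \<subseteq> N \<and> relative_regular_list (adjoin N b (carrier M)) bs"
  unfolding relative_regular_list_def by (auto simp: All_less_Suc2)

text \<open>The head is exchanged with its neighbour b, the induction hypothesis is applied over N +
  bM, and the order is restored. The condition on b itself comes from
  \<open>filter_regular_pow_adjoin\<close>.\<close>

lemma filter_regular_list_pow:
  assumes "submodule N R M" and I: "I \<subseteq> carrier R" and a: "a \<in> carrier R" and "set as \<subseteq> carrier R"
    and "filter_regular_list I N (a # as)"
  shows "filter_regular_list I N (a [^] (e::nat) # as)"
  using assms(1,4,5)
proof (induction as arbitrary: N)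
  case Nil
  then show ?case using colon_pow_le_saturation[OF _ I a] by simp
next
  case (Cons b as)
  note N = Cons.prems(1) and C = carrier_is_submodule
  have b: "b \<in> carrier R" and as: "set as \<subseteq> carrier R" using Cons.prems(2) by auto
  have reg: "colon M N a \<subseteq> saturation I N"
    "colon M (adjoin N a (carrier M)) b \<subseteq> saturation I (adjoin N a (carrier M))"
    "filter_regular_list I (adjoin (adjoin N a (carrier M)) b (carrier M)) as"
    using Cons.prems(3) by auto
  have swap: "adjoin (adjoin N c (carrier M)) b (carrier M) = adjoin (adjoin N b (carrier M)) c (carrier M)"
    if c: "c \<in> carrier R" for c
    using adjoin_commute_subset[OF N b c C] adjoin_commute_subset[OF N c b C] by blast
  have "filter_regular_list I (adjoin N b (carrier M)) (a # as)"
    using filter_regular_swap[OF N I a b reg(1,2)] reg(3) swap[OF a] by simp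
  then have "filter_regular_list I (adjoin N b (carrier M)) (a [^] e # as)"
    by (intro Cons.IH as adjoin_submodule[OF N C b])
  then show ?case
    using filter_regular_pow_adjoin[OF N I a b reg(1,2)] colon_pow_le_saturation[OF N I a reg(1)] swap a
    by simp
qed

section \<open>Relative regularity and the Artin-Rees equality\<close>

text \<open>With \<open>K = \<qq>\<^sup>nM\<close> this is \<open>\<qq>\<^sub>i\<qq>\<^sup>nM\<close>.\<close>

primrec partial_sum :: "(nat \<Rightarrow> 'a) \<Rightarrow> 'c set \<Rightarrow> nat \<Rightarrow> 'c set"
  where "partial_sum b K 0 = {\<zero>\<^bsub>M\<^esub>}"
  | "partial_sum b K (Suc i) = adjoin (partial_sum b K i) (b (Suc i)) K"

lemma partial_sum_submodule:
  assumes "submodule K R M" "\<And>j. j \<in> {1..i} \<Longrightarrow> b j \<in> carrier R"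
  shows "submodule (partial_sum b K i) R M"
  using assms(2) by (induction i) (auto intro!: submodule_zero_set adjoin_submodule assms(1))

lemma partial_sum_mono: "K \<subseteq> K' \<Longrightarrow> partial_sum b K i \<subseteq> partial_sum b K' i"
  by (induction i) (auto dest: adjoin_mono)

lemma partial_sum_mono_index:
  assumes "submodule K R M" "\<And>j. j \<in> {1..i'} \<Longrightarrow> b j \<in> carrier R" "i \<le> i'"
  shows "partial_sum b K i \<subseteq> partial_sum b K i'"
  using assms(3,2)
proof (induction i' rule: dec_induct)
  case (step m)
  have "partial_sum b K m \<subseteq> partial_sum b K (Suc m)"
    unfolding partial_sum.simps
    by (rule adjoin_upper[OF partial_sum_submodule[OF assms(1)] assms(1)]) (use step.prems in auto)
  moreover have "partial_sum b K i \<subseteq> partial_sum b K m"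
    by (rule step.IH) (use step.prems in auto)
  ultimately show ?case by (rule order_trans[rotated])
qed simp

lemma partial_sum_least:
  assumes "submodule W R M" "\<And>j y. j \<in> {1..i} \<Longrightarrow> y \<in> K \<Longrightarrow> b j \<odot>\<^bsub>M\<^esub> y \<in> W"
  shows "partial_sum b K i \<subseteq> W"
  using assms(2)
proof (induction i)
  case 0
  then show ?case using submodule_zero[OF assms(1)] by simp
next
  case (Suc i)
  have "partial_sum b K i \<subseteq> W" by (rule Suc.IH) (use Suc.prems in auto)
  moreover have "b (Suc i) \<odot>\<^bsub>M\<^esub> y \<in> W" if "y \<in> K" for y using Suc.prems[OF _ that, of "Suc i"] by simp
  ultimately show ?case using adjoin_least[OF assms(1)] by simp
qed

lemma smult_in_partial_sum:
  assumes K: "submodule K R M" and b: "\<And>j. j \<in> {1..i} \<Longrightarrow> b j \<in> carrier R"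
    and j: "j \<in> {1..i}" and y: "y \<in> K"
  shows "b j \<odot>\<^bsub>M\<^esub> y \<in> partial_sum b K i"
proof -
  obtain j' where j': "j = Suc j'" using j by (cases j) auto
  have "b j \<odot>\<^bsub>M\<^esub> y \<in> partial_sum b K j" unfolding j'
    using j' j by (auto intro!: smult_in_adjoin K y b partial_sum_submodule)
  also have "\<dots> \<subseteq> partial_sum b K i" using j b by (intro partial_sum_mono_index K) auto
  finally show ?thesis .
qed

text \<open>A bridge from sequences indexed from 1 to lists: \<open>partial_sum\<close> grows at the
  end, \<open>adjoin_list\<close> at the front.\<close>

lemma partial_sum_eq_adjoin_list:
  "partial_sum b (carrier M) i = adjoin_list {\<zero>\<^bsub>M\<^esub>} (map b [1..<Suc i])"
  by (induction i) (auto simp: adjoin_list_append)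

text \<open>With \<open>P n = \<qq>\<^sup>nM\<close> this reads \<open>\<qq>\<^sub>iM \<inter> \<qq>\<^sup>n\<^sup>+\<^sup>1M = \<qq>\<^sub>i\<qq>\<^sup>nM\<close>.\<close>

lemma relative_regular_Artin_Rees:
  assumes b: "\<And>j. j \<in> {1..r} \<Longrightarrow> b j \<in> carrier R"
    and sub: "\<And>n. submodule (P n) R M" and P0: "P 0 = carrier M"
    and PS: "\<And>n. P (Suc n) = partial_sum b (P n) r"
    and reg: "\<And>i. i < r \<Longrightarrow> colon M (partial_sum b (carrier M) i) (b (Suc i)) \<inter> P 1 \<subseteq> partial_sum b (carrier M) i"
    and "i \<le> r"
  shows "partial_sum b (carrier M) i \<inter> P (Suc n) \<subseteq> partial_sum b (P n) i"
  using \<open>i \<le> r\<close>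
proof (induction n arbitrary: i)
  case 0 then show ?case by (simp add: P0)
next
  case (Suc n)
  have P1: "P (Suc n) \<subseteq> P 1"
    using partial_sum_mono[of "P n" "P 0" b r] PS submoduleE(1)[OF sub] P0 by (metis One_nat_def)
  show ?case using Suc.prems
  \<comment> \<open>The descending induction starts at i = r, where q_r q^(n+1) M = q^(n+2) M is the
    recursion \<open>PS\<close>.\<close>
  proof (induction i rule: inc_induct)
    case base then show ?case using PS by blast
  next
    case (step i)
    note C = carrier_is_submodule
    have bi: "b (Suc i) \<in> carrier R" and bj: "\<And>j. j \<in> {1..i} \<Longrightarrow> b j \<in> carrier R" using step b by auto
    have sC: "submodule (partial_sum b (carrier M) i) R M" and sP: "submodule (partial_sum b (P (Suc n)) i) R M"
      using bj by (auto intro: partial_sum_submodule sub C)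
    have PC: "partial_sum b (P (Suc n)) i \<subseteq> partial_sum b (carrier M) i"
      using partial_sum_mono submoduleE(1)[OF sub] .
    show ?case
    proof
      fix x assume x: "x \<in> partial_sum b (carrier M) i \<inter> P (Suc (Suc n))"
      \<comment> \<open>The claim for i + 1 writes x = u + b_(i+1) z with u in q_i q^(n+1) M and z
        in q^(n+1) M. It remains to move b_(i+1) z into q_i q^(n+1) M.\<close>
      then have "x \<in> partial_sum b (P (Suc n)) (Suc i)"
        using step.IH adjoin_upper[OF sC C bi] by auto
      then obtain u z where u: "u \<in> partial_sum b (P (Suc n)) i" and z: "z \<in> P (Suc n)"
        and eq: "x = u \<oplus>\<^bsub>M\<^esub> b (Suc i) \<odot>\<^bsub>M\<^esub> z" by (auto elim: adjoinE)
      have zc: "z \<in> carrier M" and uc: "u \<in> carrier M" using submodule_carrier sub z sP u by auto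
      have "b (Suc i) \<odot>\<^bsub>M\<^esub> z = x \<ominus>\<^bsub>M\<^esub> u"
        using uc zc bi unfolding eq by (metis M.a_comm M.add.m_closed minus_eq_iff smult_closed)
      also have "\<dots> \<in> partial_sum b (carrier M) i" using x u PC by (auto intro: submodule_minus[OF sC])
      finally have "z \<in> colon M (partial_sum b (carrier M) i) (b (Suc i))" using zc by (simp add: colon_def)
      \<comment> \<open>Relative regularity applies because q^(n+1) M lies in qM. The outer
        induction hypothesis at n then improves q_i M to q_i q^n M.\<close>
      then have "z \<in> partial_sum b (carrier M) i" using reg step z P1 by auto
      then have "z \<in> partial_sum b (P n) i" using Suc.IH[of i] step z by auto
      then have "b (Suc i) \<odot>\<^bsub>M\<^esub> z \<in> partial_sum b (P (Suc n)) i"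
      proof -
        \<comment> \<open>Multiplication by b_(i+1) carries q^n M into q^(n+1) M, hence q_i q^n M
          into q_i q^(n+1) M.\<close>
        have "partial_sum b (P n) i \<subseteq> colon M (partial_sum b (P (Suc n)) i) (b (Suc i))"
        proof (rule partial_sum_least[OF colon_submodule[OF sP bi]])
          fix j y assume j: "j \<in> {1..i}" and y: "y \<in> P n"
          have yc: "y \<in> carrier M" using submodule_carrier[OF sub y] .
          have "b (Suc i) \<odot>\<^bsub>M\<^esub> y \<in> P (Suc n)" unfolding PS
            using step by (intro smult_in_partial_sum sub b y) auto
          then have "b j \<odot>\<^bsub>M\<^esub> (b (Suc i) \<odot>\<^bsub>M\<^esub> y) \<in> partial_sum b (P (Suc n)) i"
            by (intro smult_in_partial_sum sub bj j)
          then show "b j \<odot>\<^bsub>M\<^esub> y \<in> colon M (partial_sum b (P (Suc n)) i) (b (Suc i))"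
            using yc bi bj[OF j] by (simp add: colon_def smult_left_commute)
        qed
        then show ?thesis using \<open>z \<in> partial_sum b (P n) i\<close> by (auto simp: colon_def)
      qed
      then show "x \<in> partial_sum b (P (Suc n)) i" using u submodule_add[OF sP] unfolding eq by blast
    qed
  qed
qed

text \<open>Superficiality at the level of elements, read modulo q_i M. By the Artin-Rees equality y
  = u + b_(i+1) z with u in q_i q^n M and z in q^n M, so b_(i+1) (x - z) lies in q_i M. Since n >=
  1, x - z also lies in qM, and relative regularity puts it in q_i M.\<close>

lemma relative_regular_imp_superficial:
  assumes b: "\<And>j. j \<in> {1..r} \<Longrightarrow> b j \<in> carrier R"
    and sub: "\<And>n. submodule (P n) R M" and P0: "P 0 = carrier M"
    and PS: "\<And>n. P (Suc n) = partial_sum b (P n) r"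
    and reg: "\<And>i. i < r \<Longrightarrow> colon M (partial_sum b (carrier M) i) (b (Suc i)) \<inter> P 1 \<subseteq> partial_sum b (carrier M) i"
    and i: "i < r" and n: "1 \<le> n"
    and x: "x \<in> P 1" and y: "y \<in> P (Suc n)" and d: "b (Suc i) \<odot>\<^bsub>M\<^esub> x \<ominus>\<^bsub>M\<^esub> y \<in> partial_sum b (carrier M) i"
  shows "\<exists>z\<in>P n. x \<ominus>\<^bsub>M\<^esub> z \<in> partial_sum b (carrier M) i"
proof -
  note C = carrier_is_submodule
  have bi: "b (Suc i) \<in> carrier R" and bj: "\<And>j. j \<in> {1..i} \<Longrightarrow> b j \<in> carrier R" using i b by auto
  have sC: "submodule (partial_sum b (carrier M) i) R M" and sC': "submodule (partial_sum b (carrier M) (Suc i)) R M"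
    using i b by (auto intro!: partial_sum_submodule C simp del: partial_sum.simps)
  have PC: "partial_sum b (P n) i \<subseteq> partial_sum b (carrier M) i"
      using partial_sum_mono submoduleE(1)[OF sub] .
  have [simp]: "x \<in> carrier M" "y \<in> carrier M" using submodule_carrier sub x y by auto
  note [simp] = bi
  let ?v = "b (Suc i) \<odot>\<^bsub>M\<^esub> x \<ominus>\<^bsub>M\<^esub> y"
  \<comment> \<open>Up to an element of q_i M, y equals b_(i+1) x. Hence y is in q_(i+1) M, and the
    Artin-Rees equality applies to it.\<close>
  have "b (Suc i) \<odot>\<^bsub>M\<^esub> x \<in> partial_sum b (carrier M) (Suc i)"
    using i by (intro smult_in_partial_sum C b) auto
  moreover have "?v \<in> partial_sum b (carrier M) (Suc i)"
    using d adjoin_upper[OF sC C bi] by auto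
  ultimately have "b (Suc i) \<odot>\<^bsub>M\<^esub> x \<ominus>\<^bsub>M\<^esub> ?v \<in> partial_sum b (carrier M) (Suc i)"
    by (rule submodule_minus[OF sC'])
  also have "b (Suc i) \<odot>\<^bsub>M\<^esub> x \<ominus>\<^bsub>M\<^esub> ?v = y"
    by (metis M.a_comm M.minus_closed \<open>x \<in> carrier M\<close> \<open>y \<in> carrier M\<close> bi minus_eq_iff smult_closed)
  finally have "y \<in> partial_sum b (P n) (Suc i)"
    using relative_regular_Artin_Rees[OF b sub P0 PS reg, of "Suc i" n] i y by auto
  then obtain u z where u: "u \<in> partial_sum b (P n) i" and z: "z \<in> P n"
    and eq: "y = u \<oplus>\<^bsub>M\<^esub> b (Suc i) \<odot>\<^bsub>M\<^esub> z" by (auto elim: adjoinE)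
  have [simp]: "z \<in> carrier M" "u \<in> carrier M" using submodule_carrier sub z sC u PC by auto
  have "b (Suc i) \<odot>\<^bsub>M\<^esub> (x \<ominus>\<^bsub>M\<^esub> z) = ?v \<oplus>\<^bsub>M\<^esub> u"
    unfolding eq by (simp add: smult_minus a_minus_def M.minus_add M.a_ac M.r_neg1 M.r_neg2 smult_r_distr smult_r_minus)
  also have "\<dots> \<in> partial_sum b (carrier M) i" using d u PC by (auto intro: submodule_add[OF sC])
  finally have "x \<ominus>\<^bsub>M\<^esub> z \<in> colon M (partial_sum b (carrier M) i) (b (Suc i))" by (simp add: colon_def)
  moreover have "P n \<subseteq> P 1"
    using n PS[of "n - 1"] partial_sum_mono[of "P (n - 1)" "P 0" b r] PS[of 0] submoduleE(1)[OF sub] P0 by simp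
  then have "x \<ominus>\<^bsub>M\<^esub> z \<in> P 1" using x z by (auto intro: submodule_minus[OF sub])
  ultimately show ?thesis using reg[OF i] z by blast
qed

end

section \<open>Finitely generated modules over Noetherian rings\<close>

text \<open>Zorn's lemma applies because a nonempty chain of ideals in a Noetherian ring contains
  its union.\<close>

lemma (in noetherian_ring) ideal_family_maximal:
  assumes "F \<noteq> {}" "\<And>I. I \<in> F \<Longrightarrow> ideal I R"
  shows "\<exists>I\<in>F. \<forall>J\<in>F. I \<subseteq> J \<longrightarrow> J = I"
proof (rule subset_Zorn_nonempty[OF assms(1)])
  fix C assume C: "C \<noteq> {}" "subset.chain F C"
  then have "subset.chain {I. ideal I R} C" "C \<subseteq> F"
    using assms(2) by (auto simp: subset_chain_def)
  then show "\<Union>C \<in> F" using ideal_chain_is_trivial[OF C(1)] by blast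
qed

section \<open>The maximal condition on submodules\<close>

locale fg_module = module R M + noetherian_ring R for R (structure) and M (structure) +
  assumes fg: "finitely_generated R M"
begin

text \<open>For a submodule W this says that W is a Noetherian module. W is kept as a subset of M so
  that it can be enlarged by one generator at a time.\<close>

definition max_condition :: "'c set \<Rightarrow> bool"
  where "max_condition W \<longleftrightarrow>
    (\<forall>F. F \<noteq> {} \<longrightarrow> (\<forall>N\<in>F. submodule N R M \<and> N \<subseteq> W) \<longrightarrow> (\<exists>N\<in>F. \<forall>N'\<in>F. N \<subseteq> N' \<longrightarrow> N' = N))"

text \<open>In W' = Rs + W, nested submodules N coincide as soon as their coefficient ideals
  \<open>lead N\<close> and their intersections with W do. A maximal member is therefore found by
  maximising first the ideal and then the intersection.\<close>

lemma max_condition_insert: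
  assumes W: "submodule W R M" and max: "max_condition W" and s: "s \<in> carrier M"
  shows "\<exists>W'. submodule W' R M \<and> W \<subseteq> W' \<and> s \<in> W' \<and> max_condition W'"
proof -
  have Wc: "w \<in> W \<Longrightarrow> w \<in> carrier M" for w using W by (rule submodule_carrier)
  define W' where "W' = {c \<odot>\<^bsub>M\<^esub> s \<oplus>\<^bsub>M\<^esub> w | c w. c \<in> carrier R \<and> w \<in> W}"
  have W'I: "c \<odot>\<^bsub>M\<^esub> s \<oplus>\<^bsub>M\<^esub> w \<in> W'" if "c \<in> carrier R" "w \<in> W" for c w
    using that by (auto simp: W'_def)
  have sW': "submodule W' R M"
  proof (rule submoduleI)
    show "W' \<subseteq> carrier M" using Wc s by (auto simp: W'_def)
    show "\<zero>\<^bsub>M\<^esub> \<in> W'" using W'I[OF R.zero_closed submodule_zero[OF W]] s by simp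
    fix x assume "x \<in> W'"
    then obtain c w where x: "c \<in> carrier R" "w \<in> W" "x = c \<odot>\<^bsub>M\<^esub> s \<oplus>\<^bsub>M\<^esub> w" by (auto simp: W'_def)
    have "\<ominus>\<^bsub>M\<^esub> x = (\<ominus> c) \<odot>\<^bsub>M\<^esub> s \<oplus>\<^bsub>M\<^esub> (\<ominus>\<^bsub>M\<^esub> w)"
      using x s Wc by (simp add: smult_l_minus M.minus_add)
    then show "\<ominus>\<^bsub>M\<^esub> x \<in> W'" using W'I[of "\<ominus> c" "\<ominus>\<^bsub>M\<^esub> w"] x submoduleE(3)[OF W] by auto
    { fix y assume "y \<in> W'"
      then obtain d v where y: "d \<in> carrier R" "v \<in> W" "y = d \<odot>\<^bsub>M\<^esub> s \<oplus>\<^bsub>M\<^esub> v" by (auto simp: W'_def)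
      have "x \<oplus>\<^bsub>M\<^esub> y = (c \<oplus> d) \<odot>\<^bsub>M\<^esub> s \<oplus>\<^bsub>M\<^esub> (w \<oplus>\<^bsub>M\<^esub> v)"
        using x y s Wc by (simp add: smult_l_distr M.a_ac)
      then show "x \<oplus>\<^bsub>M\<^esub> y \<in> W'" using W'I[of "c \<oplus> d" "w \<oplus>\<^bsub>M\<^esub> v"] x y submodule_add[OF W] by auto }
    fix d assume d: "d \<in> carrier R"
    have "d \<odot>\<^bsub>M\<^esub> x = (d \<otimes> c) \<odot>\<^bsub>M\<^esub> s \<oplus>\<^bsub>M\<^esub> d \<odot>\<^bsub>M\<^esub> w"
      using x d s Wc by (simp add: smult_r_distr smult_assoc1)
    then show "d \<odot>\<^bsub>M\<^esub> x \<in> W'" using W'I[of "d \<otimes> c" "d \<odot>\<^bsub>M\<^esub> w"] x d submodule_smult[OF W] by auto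
  qed
  \<comment> \<open>The ideal of coefficients of \<open>s\<close> modulo W: all c with c s in N +
    W.\<close>
  define lead where "lead N = {c \<in> carrier R. \<exists>w\<in>W. c \<odot>\<^bsub>M\<^esub> s \<oplus>\<^bsub>M\<^esub> w \<in> N}" for N
  have leadI: "c \<in> lead N" if "c \<in> carrier R" "w \<in> W" "c \<odot>\<^bsub>M\<^esub> s \<oplus>\<^bsub>M\<^esub> w \<in> N" for c w N
    using that by (auto simp: lead_def)
  have ideal: "ideal (lead N) R" if N: "submodule N R M" for N
  proof (rule idealI)
    show "ring R" by (rule R.ring_axioms)
    have smult: "d \<otimes> c \<in> lead N" if "c \<in> lead N" "d \<in> carrier R" for c d
    proof -
      from that obtain w where w: "w \<in> W" "c \<in> carrier R" "c \<odot>\<^bsub>M\<^esub> s \<oplus>\<^bsub>M\<^esub> w \<in> N" by (auto simp: lead_def)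
      have "(d \<otimes> c) \<odot>\<^bsub>M\<^esub> s \<oplus>\<^bsub>M\<^esub> d \<odot>\<^bsub>M\<^esub> w = d \<odot>\<^bsub>M\<^esub> (c \<odot>\<^bsub>M\<^esub> s \<oplus>\<^bsub>M\<^esub> w)"
        using w that s Wc by (simp add: smult_r_distr smult_assoc1)
      then show ?thesis
        using leadI[of "d \<otimes> c" "d \<odot>\<^bsub>M\<^esub> w" N] w that submodule_smult[OF N] submodule_smult[OF W] by simp
    qed
    have add: "c \<oplus> d \<in> lead N" if "c \<in> lead N" "d \<in> lead N" for c d
    proof -
      from that obtain w v where w: "w \<in> W" "c \<in> carrier R" "c \<odot>\<^bsub>M\<^esub> s \<oplus>\<^bsub>M\<^esub> w \<in> N"
        and v: "v \<in> W" "d \<in> carrier R" "d \<odot>\<^bsub>M\<^esub> s \<oplus>\<^bsub>M\<^esub> v \<in> N" by (auto simp: lead_def)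
      have "(c \<oplus> d) \<odot>\<^bsub>M\<^esub> s \<oplus>\<^bsub>M\<^esub> (w \<oplus>\<^bsub>M\<^esub> v) = (c \<odot>\<^bsub>M\<^esub> s \<oplus>\<^bsub>M\<^esub> w) \<oplus>\<^bsub>M\<^esub> (d \<odot>\<^bsub>M\<^esub> s \<oplus>\<^bsub>M\<^esub> v)"
        using w v s Wc by (simp add: smult_l_distr M.a_ac)
      then show ?thesis
        using leadI[of "c \<oplus> d" "w \<oplus>\<^bsub>M\<^esub> v" N] w v submodule_add[OF N] submodule_add[OF W] by simp
    qed
    show "subgroup (lead N) (add_monoid R)"
    proof (rule R.add.subgroupI)
      show "lead N \<subseteq> carrier R" by (auto simp: lead_def)
      show "lead N \<noteq> {}"
        using leadI[OF R.zero_closed submodule_zero[OF W], of N] submodule_zero[OF N] s by auto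
      fix c assume c: "c \<in> lead N"
      then have "c \<in> carrier R" by (simp add: lead_def)
      then have "\<ominus> c = (\<ominus> \<one>) \<otimes> c" by (simp add: R.l_minus)
      then show "\<ominus> c \<in> lead N" using smult[OF c] by simp
    qed (use add in auto)
    fix c d assume cd: "c \<in> lead N" "d \<in> carrier R"
    then show "d \<otimes> c \<in> lead N" by (rule smult)
    then show "c \<otimes> d \<in> lead N" using cd by (simp add: lead_def R.m_comm)
  qed
  have lead_mono: "lead N \<subseteq> lead N'" if "N \<subseteq> N'" for N N' using that by (auto simp: lead_def)
  \<comment> \<open>For x in N' the equality of coefficient ideals yields an element of N with the
    same coefficient of \<open>s\<close>. The difference lies in N' \<inter> W = N \<inter>
    W.\<close>
  have eq: "N' = N" if N: "submodule N R M" and N': "submodule N' R M" "N' \<subseteq> W'" and le: "N \<subseteq> N'"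
    and lead: "lead N' = lead N" and int: "N' \<inter> W = N \<inter> W" for N N'
  proof (intro equalityI le subsetI)
    fix x assume x: "x \<in> N'"
    then obtain c w where c: "c \<in> carrier R" "w \<in> W" "x = c \<odot>\<^bsub>M\<^esub> s \<oplus>\<^bsub>M\<^esub> w" using N' by (auto simp: W'_def)
    then have "c \<in> lead N" using leadI x lead by auto
    then obtain v where v: "v \<in> W" "c \<odot>\<^bsub>M\<^esub> s \<oplus>\<^bsub>M\<^esub> v \<in> N" by (auto simp: lead_def)
    let ?y = "c \<odot>\<^bsub>M\<^esub> s \<oplus>\<^bsub>M\<^esub> v"
    have "x \<ominus>\<^bsub>M\<^esub> ?y = w \<ominus>\<^bsub>M\<^esub> v"
      using c v s Wc by (intro minus_eq_minusI) (simp_all add: M.a_ac)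
    moreover have "x \<ominus>\<^bsub>M\<^esub> ?y \<in> N'" using x v le by (auto intro: submodule_minus[OF N'(1)])
    moreover have "w \<ominus>\<^bsub>M\<^esub> v \<in> W" using c v by (auto intro: submodule_minus[OF W])
    ultimately have "x \<ominus>\<^bsub>M\<^esub> ?y \<in> N" using int by auto
    then show "x \<in> N" using submodule_minusD[OF N _ v(2)] submodule_carrier[OF N'(1) x] by blast
  qed
  have "max_condition W'" unfolding max_condition_def
  proof (intro allI impI)
    fix F assume F: "F \<noteq> {}" "\<forall>N\<in>F. submodule N R M \<and> N \<subseteq> W'"
    have "\<exists>I\<in>lead ` F. \<forall>J\<in>lead ` F. I \<subseteq> J \<longrightarrow> J = I"
      using F ideal by (intro ideal_family_maximal) auto
    then obtain N1 where N1: "N1 \<in> F" "\<And>N. N \<in> F \<Longrightarrow> lead N1 \<subseteq> lead N \<Longrightarrow> lead N = lead N1" by blast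
    \<comment> \<open>Only members with the same coefficient ideal as \<open>N1\<close> compete
      here. Any member of \<open>F\<close> above one of them has that ideal too, by the choice of
      \<open>N1\<close>.\<close>
    let ?G = "(\<lambda>N. N \<inter> W) ` {N \<in> F. lead N = lead N1}"
    have "?G \<noteq> {}" "\<forall>N\<in>?G. submodule N R M \<and> N \<subseteq> W" using N1 F W submodule_Int by auto
    then obtain K where K: "K \<in> ?G" "\<forall>N'\<in>?G. K \<subseteq> N' \<longrightarrow> N' = K"
      using max unfolding max_condition_def by meson
    from K(1) obtain N2 where N2: "N2 \<in> F" "lead N2 = lead N1" "K = N2 \<inter> W" by auto
    have "N' = N2" if N': "N' \<in> F" "N2 \<subseteq> N'" for N'
    proof (rule eq)
      show lead: "lead N' = lead N2" using N1 N2 N' lead_mono by metis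
      have "N' \<inter> W \<in> ?G" using lead N2 N' by auto
      moreover have "K \<subseteq> N' \<inter> W" using N2 N' by auto
      ultimately have "N' \<inter> W = K" using K(2) by blast
      then show "N' \<inter> W = N2 \<inter> W" using N2 by simp
    qed (use F N2 N' in auto)
    then show "\<exists>N\<in>F. \<forall>N'\<in>F. N \<subseteq> N' \<longrightarrow> N' = N" using N2(1) by blast
  qed
  moreover have "W \<subseteq> W'"
  proof
    fix w assume w: "w \<in> W"
    then show "w \<in> W'" using W'I[OF R.zero_closed w] s Wc by simp
  qed
  moreover have "s \<in> W'" using W'I[OF R.one_closed submodule_zero[OF W]] s by simp
  ultimately show ?thesis using sW' by blast
qed

lemma max_condition_finite:
  "finite S \<Longrightarrow> S \<subseteq> carrier M \<Longrightarrow> \<exists>W. submodule W R M \<and> S \<subseteq> W \<and> max_condition W"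
proof (induction rule: finite_induct)
  case empty
  have "max_condition {\<zero>\<^bsub>M\<^esub>}" unfolding max_condition_def
  proof (intro allI impI)
    fix F assume F: "F \<noteq> {}" "\<forall>N\<in>F. submodule N R M \<and> N \<subseteq> {\<zero>\<^bsub>M\<^esub>}"
    have "N = {\<zero>\<^bsub>M\<^esub>}" if "N \<in> F" for N using F(2) that submodule_zero by blast
    then show "\<exists>N\<in>F. \<forall>N'\<in>F. N \<subseteq> N' \<longrightarrow> N' = N" using F(1) by blast
  qed
  then show ?case using submodule_zero_set by blast
next
  case (insert s S)
  then obtain W where W: "submodule W R M" "S \<subseteq> W" "max_condition W" by auto
  obtain W' where "submodule W' R M" "W \<subseteq> W'" "s \<in> W'" "max_condition W'"
    using max_condition_insert[OF W(1,3), of s] insert.prems by auto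
  then show ?case using W(2) by blast
qed

text \<open>A submodule that satisfies the maximal condition and contains a finite generating set is
  all of M.\<close>

lemma submodule_family_maximal:
  assumes "F \<noteq> {}" "\<And>N. N \<in> F \<Longrightarrow> submodule N R M"
  shows "\<exists>N\<in>F. \<forall>N'\<in>F. N \<subseteq> N' \<longrightarrow> N' = N"
proof -
  obtain S where S: "finite S" "S \<subseteq> carrier M" "submodule_gen R M S = carrier M"
    using fg by (auto simp: finitely_generated_def)
  obtain W where W: "submodule W R M" "S \<subseteq> W" "max_condition W"
    using max_condition_finite[OF S(1,2)] by blast
  have "submodule_gen R M S \<subseteq> W" using W by (auto simp: submodule_gen_def)
  then have "\<forall>N\<in>F. submodule N R M \<and> N \<subseteq> W"
    using S(3) assms(2) submoduleE(1) by (metis order_trans)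
  with W(3)[unfolded max_condition_def, THEN spec, THEN mp, OF assms(1)] show ?thesis by (rule mp)
qed

section \<open>Stationary colons, associated primes and complements\<close>

lemma colon_pow_stationary:
  assumes N: "submodule N R M" and b: "b \<in> carrier R"
  shows "\<exists>k::nat. \<forall>j::nat. colon M N (b [^] j) \<subseteq> colon M N (b [^] k)"
proof -
  let ?C = "\<lambda>j::nat. colon M N (b [^] j)"
  have "\<exists>K\<in>range ?C. \<forall>K'\<in>range ?C. K \<subseteq> K' \<longrightarrow> K' = K"
    using colon_submodule[OF N] b by (intro submodule_family_maximal) auto
  then obtain k where k: "\<And>j. ?C k \<subseteq> ?C j \<Longrightarrow> ?C j = ?C k" by auto
  have mono: "?C i \<subseteq> ?C j" if "i \<le> j" for i j
    using pow_smult_mono[OF N b _ _ that] by (auto simp: colon_def)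
  have "?C j \<subseteq> ?C k" for j
    using mono[of j "max j k"] mono[of k "max j k"] k[of "max j k"] by auto
  then show ?thesis by blast
qed

text \<open>A maximal member among the annihilators modulo the saturation of \<open>N\<close> is prime, and
  multiplying its element by a high power of some \<open>b \<in> I\<close> outside this prime makes it associated
  to \<open>M/N\<close>.\<close>

lemma colon_le_saturation_if_avoids_Ass:
  assumes N: "submodule N R M" and I: "I \<subseteq> carrier R" and a: "a \<in> carrier R"
    and avoid: "\<And>\<pp> x. primeideal \<pp> R \<Longrightarrow> x \<in> carrier M \<Longrightarrow> \<pp> = {c \<in> carrier R. c \<odot>\<^bsub>M\<^esub> x \<in> N} \<Longrightarrow>
      \<not> I \<subseteq> \<pp> \<Longrightarrow> a \<notin> \<pp>"
  shows "colon M N a \<subseteq> saturation I N"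
proof (rule ccontr)
  assume "\<not> ?thesis"
  then obtain x where x: "x \<in> carrier M" "a \<odot>\<^bsub>M\<^esub> x \<in> N" "x \<notin> saturation I N" by (auto simp: colon_def)
  define S where "S = saturation I N"
  have S: "submodule S R M" unfolding S_def by (rule saturation_submodule[OF N I])
  have NS: "N \<subseteq> S" unfolding S_def by (rule saturation_le[OF N I])
  \<comment> \<open>Annihilators are taken modulo the saturation \<open>S\<close>, not modulo N.
    Restricting to z with a z in S forces \<open>a\<close> into the prime that is found, which gives
    the contradiction at the end.\<close>
  define ann where "ann z = {c \<in> carrier R. c \<odot>\<^bsub>M\<^esub> z \<in> S}" for z
  define Z where "Z = {z \<in> carrier M. z \<notin> S \<and> a \<odot>\<^bsub>M\<^esub> z \<in> S}"
  have ideal_ann: "ideal (ann z) R" if z: "z \<in> carrier M" for z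
  proof (rule idealI)
    show "ring R" by (rule R.ring_axioms)
    show "subgroup (ann z) (add_monoid R)"
    proof (rule R.add.subgroupI)
      show "ann z \<noteq> {}" using z submodule_zero[OF S] by (auto simp: ann_def intro!: exI[of _ \<zero>])
    qed (use z submoduleE(3)[OF S] submodule_add[OF S] in
        \<open>auto simp: ann_def a_inv_def[symmetric] smult_l_minus smult_l_distr\<close>)
    fix c d assume "c \<in> ann z" "d \<in> carrier R"
    then show "d \<otimes> c \<in> ann z" "c \<otimes> d \<in> ann z"
      using z submodule_smult[OF S, of d] by (auto simp: ann_def smult_assoc1 R.m_comm[of c d])
  qed
  have "x \<in> Z" using x NS by (auto simp: Z_def S_def)
  then have "\<exists>p\<in>ann ` Z. \<forall>p'\<in>ann ` Z. p \<subseteq> p' \<longrightarrow> p' = p"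
    using ideal_ann by (intro ideal_family_maximal) (auto simp: Z_def)
  then obtain z where z: "z \<in> Z" and max: "\<And>y. y \<in> Z \<Longrightarrow> ann z \<subseteq> ann y \<Longrightarrow> ann y = ann z" by blast
  have zc: "z \<in> carrier M" and zS: "z \<notin> S" and az: "a \<odot>\<^bsub>M\<^esub> z \<in> S" using z by (auto simp: Z_def)
  have prime: "primeideal (ann z) R"
  proof (rule primeidealI[OF ideal_ann[OF zc] R.is_cring])
    have "\<one> \<notin> ann z" using zc zS by (simp add: ann_def)
    then show "carrier R \<noteq> ann z" using R.one_closed by blast
    fix c d assume c: "c \<in> carrier R" and d: "d \<in> carrier R" and cd: "c \<otimes> d \<in> ann z"
    show "c \<in> ann z \<or> d \<in> ann z"
    proof (rule disjCI)
      \<comment> \<open>Then d z is again a member of \<open>Z\<close>, and its annihilator contains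
        that of z, so maximality makes the two equal.\<close>
      assume "d \<notin> ann z"
      then have "d \<odot>\<^bsub>M\<^esub> z \<notin> S" using d by (simp add: ann_def)
      moreover have "a \<odot>\<^bsub>M\<^esub> (d \<odot>\<^bsub>M\<^esub> z) \<in> S"
        using submodule_smult[OF S d az] a d zc by (simp add: smult_left_commute)
      ultimately have "d \<odot>\<^bsub>M\<^esub> z \<in> Z" using d zc by (simp add: Z_def)
      moreover have "ann z \<subseteq> ann (d \<odot>\<^bsub>M\<^esub> z)"
        using submodule_smult[OF S d] d zc by (auto simp: ann_def smult_left_commute[of _ d])
      ultimately have "ann (d \<odot>\<^bsub>M\<^esub> z) = ann z" by (rule max)
      moreover have "c \<in> ann (d \<odot>\<^bsub>M\<^esub> z)" using cd c d zc by (simp add: ann_def smult_assoc1)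
      ultimately show "c \<in> ann z" by simp
    qed
  qed
  \<comment> \<open>Otherwise z would lie in the saturation of the saturation, which is
    \<open>S\<close> again.\<close>
  have "\<not> I \<subseteq> ann z"
  proof
    assume sub: "I \<subseteq> ann z"
    have "z \<in> saturation I N"
    proof (rule saturation_idem[OF N I zc])
      fix b assume "b \<in> I"
      then have "b \<odot>\<^bsub>M\<^esub> z \<in> S" "b \<in> carrier R" using sub by (auto simp: ann_def)
      then have "b [^] (1::nat) \<odot>\<^bsub>M\<^esub> z \<in> saturation I N" by (simp add: S_def)
      then show "\<exists>k::nat. b [^] k \<odot>\<^bsub>M\<^esub> z \<in> saturation I N" by blast
    qed
    then show False using zS by (simp add: S_def)
  qed
  then obtain b where b: "b \<in> I" "b \<notin> ann z" by blast
  then have bc: "b \<in> carrier R" using I by blast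
  \<comment> \<open>One exponent for all scalars: if b^j c z is in N for some j, then b^t c z is in
    N. This is why b^t z has modulo N the annihilator that z has modulo \<open>S\<close>.\<close>
  obtain t :: nat where t: "\<And>j::nat. colon M N (b [^] j) \<subseteq> colon M N (b [^] t)"
    using colon_pow_stationary[OF N bc] by blast
  have pow: "b [^] k \<notin> ann z" for k :: nat
  proof (induction k)
    case 0 then show ?case using zc zS by (simp add: ann_def)
  next
    case (Suc k) then show ?case using primeideal.I_prime[OF prime, of "b [^] k" b] b bc by auto
  qed
  have "ann z = {c \<in> carrier R. c \<odot>\<^bsub>M\<^esub> (b [^] t \<odot>\<^bsub>M\<^esub> z) \<in> N}" (is "_ = ?A")
  proof (intro equalityI subsetI)
    fix c assume "c \<in> ann z"
    then have c: "c \<in> carrier R" "c \<odot>\<^bsub>M\<^esub> z \<in> saturation I N" by (auto simp: ann_def S_def)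
    then obtain j :: nat where "b [^] j \<odot>\<^bsub>M\<^esub> (c \<odot>\<^bsub>M\<^esub> z) \<in> N" using b by (auto simp: saturation_def)
    then have "c \<odot>\<^bsub>M\<^esub> z \<in> colon M N (b [^] j)" using c zc by (simp add: colon_def)
    then have "b [^] t \<odot>\<^bsub>M\<^esub> (c \<odot>\<^bsub>M\<^esub> z) \<in> N" using t by (auto simp: colon_def)
    then show "c \<in> ?A" using c bc zc by (simp add: smult_left_commute)
  next
    \<comment> \<open>Conversely c b^t lies in the prime \<open>ann z\<close>, which contains no
      power of b.\<close>
    fix c assume "c \<in> ?A"
    then have c: "c \<in> carrier R" "c \<odot>\<^bsub>M\<^esub> (b [^] t \<odot>\<^bsub>M\<^esub> z) \<in> S" using NS by auto
    then have "c \<otimes> b [^] t \<in> ann z" using bc zc by (simp add: ann_def smult_assoc1)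
    then show "c \<in> ann z" using primeideal.I_prime[OF prime c(1), of "b [^] t"] pow bc by auto
  qed
  then have "a \<notin> ann z" using avoid[OF prime _ _ \<open>\<not> I \<subseteq> ann z\<close>] bc zc by simp
  then show False using az a by (simp add: ann_def)
qed

text \<open>The substitute for the Artin-Rees lemma: a submodule \<open>W \<supseteq> N\<close> maximal with
  \<open>W \<inter> saturation I N = N\<close> contains \<open>b\<^sup>kM\<close> for large \<open>k\<close>.\<close>

lemma complement_of_saturation:
  assumes N: "submodule N R M" and I: "I \<subseteq> carrier R"
  shows "\<exists>W. submodule W R M \<and> N \<subseteq> W \<and> W \<inter> saturation I N \<subseteq> N \<and>
    (\<forall>b\<in>I. \<exists>k::nat. \<forall>y\<in>carrier M. b [^] k \<odot>\<^bsub>M\<^esub> y \<in> W)"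
proof -
  let ?F = "{W. submodule W R M \<and> N \<subseteq> W \<and> W \<inter> saturation I N \<subseteq> N}"
  \<comment> \<open>The family is nonempty because \<open>N\<close> belongs to it.\<close>
  have "\<exists>W\<in>?F. \<forall>W'\<in>?F. W \<subseteq> W' \<longrightarrow> W' = W"
    using N by (intro submodule_family_maximal) auto
  then obtain W where WF: "W \<in> ?F" and *: "\<forall>W'\<in>?F. W \<subseteq> W' \<longrightarrow> W' = W" by (rule bexE)
  have max: "W' = W" if "W' \<in> ?F" "W \<subseteq> W'" for W' using bspec[OF * that(1)] that(2) by (rule mp)
  have W: "submodule W R M" and NW: "N \<subseteq> W" and WN: "W \<inter> saturation I N \<subseteq> N" using WF by auto
  note C = carrier_is_submodule
  have "\<exists>k::nat. \<forall>y\<in>carrier M. b [^] k \<odot>\<^bsub>M\<^esub> y \<in> W" if b: "b \<in> I" for b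
  proof -
    have bc: "b \<in> carrier R" using b I by blast
    obtain k :: nat where k: "\<And>j::nat. colon M W (b [^] j) \<subseteq> colon M W (b [^] k)"
      using colon_pow_stationary[OF W bc] by blast
    have bk: "b [^] k \<in> carrier R" using bc by simp
    let ?W = "adjoin W (b [^] k) (carrier M)"
    \<comment> \<open>Enlarging W by b^k M stays within the family. If x = w + b^k m and b^l x is in
      N, then b^(l+k) m is in W, and stationarity lowers the exponent back to k, so x is in W.
      Maximality of W then yields b^k M inside W.\<close>
    have "?W \<inter> saturation I N \<subseteq> N"
    proof
      fix x assume x: "x \<in> ?W \<inter> saturation I N"
      then obtain w m where w: "w \<in> W" "m \<in> carrier M" and eq: "x = w \<oplus>\<^bsub>M\<^esub> b [^] k \<odot>\<^bsub>M\<^esub> m"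
        by (auto elim: adjoinE)
      obtain l :: nat where l: "b [^] l \<odot>\<^bsub>M\<^esub> x \<in> N" using x b by (auto simp: saturation_def)
      have wc: "w \<in> carrier M" using submodule_carrier[OF W w(1)] .
      have "b [^] l \<odot>\<^bsub>M\<^esub> x = b [^] (l + k) \<odot>\<^bsub>M\<^esub> m \<oplus>\<^bsub>M\<^esub> b [^] l \<odot>\<^bsub>M\<^esub> w"
        unfolding eq using w wc bc by (simp add: smult_r_distr pow_smult_add M.a_comm)
      then have "b [^] (l + k) \<odot>\<^bsub>M\<^esub> m = b [^] l \<odot>\<^bsub>M\<^esub> x \<ominus>\<^bsub>M\<^esub> b [^] l \<odot>\<^bsub>M\<^esub> w"
        using minus_eq_iff[THEN iffD2, symmetric] w wc bc saturationD x by auto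
      also have "\<dots> \<in> W" using l NW submodule_smult[OF W _ w(1), of "b [^] l"] bc by (intro submodule_minus[OF W]) auto
      finally have "m \<in> colon M W (b [^] (l + k))" using w by (simp add: colon_def)
      then have "b [^] k \<odot>\<^bsub>M\<^esub> m \<in> W" using k by (auto simp: colon_def)
      then have "x \<in> W" unfolding eq using w by (auto intro: submodule_add[OF W])
      then show "x \<in> N" using WN x by blast
    qed
    then have "?W \<in> ?F" using adjoin_submodule[OF W C bk] adjoin_upper[OF W C bk] NW by auto
    then have "?W = W" using adjoin_upper[OF W C bk] by (rule max)
    then show ?thesis using smult_in_adjoin[OF W C bk] by auto
  qed
  then show ?thesis using W NW WN by blast
qed

text \<open>Exponents are chosen from the front with the lower bound \<open>m\<close> arbitrary.
  Passing e on as the bound for the tail gives sortedness and makes all later powers carry M into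
  the complement W belonging to N. The submodule built from all the powers then lies in W, whereas N
  : a^e lies in the saturation, and W meets the saturation only in N.\<close>

lemma exists_relative_regular_powers:
  assumes "submodule N R M" and I: "I \<subseteq> carrier R" and "set as \<subseteq> I" and "filter_regular_list I N as"
  shows "\<exists>es :: nat list. length es = length as \<and> sorted es \<and> (\<forall>e\<in>set es. m \<le> e) \<and>
    relative_regular_list N (map2 ([^]) as es)"
  using assms(1,3,4)
proof (induction as arbitrary: N m)
  case Nil then show ?case by simp
next
  case (Cons a as)
  note N = Cons.prems(1) and C = carrier_is_submodule
  have a: "a \<in> carrier R" and as: "set as \<subseteq> carrier R" using Cons.prems I by auto
  obtain W where W: "submodule W R M" "N \<subseteq> W" "W \<inter> saturation I N \<subseteq> N"
    and "\<forall>b\<in>I. \<exists>k::nat. \<forall>y\<in>carrier M. b [^] k \<odot>\<^bsub>M\<^esub> y \<in> W"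
    using complement_of_saturation[OF N I] by blast
  then obtain k :: "'a \<Rightarrow> nat" where k: "\<And>b y. b \<in> I \<Longrightarrow> y \<in> carrier M \<Longrightarrow> b [^] k b \<odot>\<^bsub>M\<^esub> y \<in> W" by metis
  \<comment> \<open>The maximum runs over all remaining elements, not just the head, since all later
    powers must carry M into the same W.\<close>
  define e where "e = Max (insert m (k ` set (a # as)))"
  have "m \<le> e" unfolding e_def by (intro Max_ge) auto
  have pow: "b [^] j \<odot>\<^bsub>M\<^esub> y \<in> W" if "b \<in> set (a # as)" "e \<le> j" "y \<in> carrier M" for b y j
  proof -
    have "k b \<le> e" unfolding e_def using that by (intro Max_ge) auto
    moreover have b: "b \<in> I" using that(1) Cons.prems(2) by blast
    ultimately show ?thesis
      using pow_smult_mono[OF W(1) _ that(3) k[OF b that(3)], of j] that(2) I by auto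
  qed
  let ?N = "adjoin N (a [^] e) (carrier M)"
  have sN: "submodule ?N R M" using a by (intro adjoin_submodule[OF N C]) simp
  \<comment> \<open>The head is raised to its power before the tail is treated, because the tail is
    considered over N + a^e M.\<close>
  have reg: "filter_regular_list I N (a [^] e # as)"
    using filter_regular_list_pow[OF N I a as Cons.prems(3)] .
  then have "filter_regular_list I ?N as" "set as \<subseteq> I" using Cons.prems(2) by simp_all
  then obtain es where es: "length es = length as" "sorted es" "\<forall>e'\<in>set es. e \<le> e'"
    "relative_regular_list ?N (map2 ([^]) as es)"
    using Cons.IH[OF sN, of e] by blast
  have "adjoin_list N (map2 ([^]) (a # as) (e # es)) \<subseteq> W"
  proof (rule adjoin_list_least[OF W(1,2)])
    fix b y assume b: "b \<in> set (map2 ([^]) (a # as) (e # es))" and y: "y \<in> carrier M"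
    from b obtain p where p: "b = (\<lambda>(c, j). c [^] j) p" "p \<in> set (zip (a # as) (e # es))"
      unfolding set_map by (rule imageE)
    obtain c j where "p = (c, j)" by (cases p)
    with p have cj: "(c, j) \<in> set (zip (a # as) (e # es))" and "b = c [^] j" by (simp_all only: prod.case)
    moreover have "c \<in> set (a # as)" "j \<in> set (e # es)"
      using set_zip_leftD[OF cj] set_zip_rightD[OF cj] .
    ultimately show "b \<odot>\<^bsub>M\<^esub> y \<in> W" using pow[OF _ _ y, of c j] es(3) by auto
  qed
  then have "colon M N (a [^] e) \<inter> adjoin_list N (map2 ([^]) (a # as) (e # es)) \<subseteq> N"
    using reg W(3) unfolding filter_regular_list_Cons by blast
  then have "relative_regular_list N (map2 ([^]) (a # as) (e # es))"
    using es(4) by (simp only: zip_Cons_Cons list.map prod.case relative_regular_list_Cons simp_thms)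
  moreover have "sorted (e # es)" "\<forall>e'\<in>set (e # es). m \<le> e'" "length (e # es) = length (a # as)"
    using es(1-3) \<open>m \<le> e\<close> by auto
  ultimately show ?case by blast
qed

end

section \<open>Ideals and quotient modules\<close>

context module
begin

section \<open>Multiples of a module by ideals\<close>

lemma ideal_smult_submodule:
  assumes "J \<subseteq> carrier R"
  shows "submodule (ideal_smult R J M) R M"
proof -
  let ?F = "{N. submodule N R M \<and> {c \<odot>\<^bsub>M\<^esub> x | c x. c \<in> J \<and> x \<in> carrier M} \<subseteq> N}"
  have C: "carrier M \<in> ?F" using assms carrier_is_submodule by auto
  have "submodule (\<Inter>?F) R M"
  proof (rule submoduleI)
    show "\<Inter>?F \<subseteq> carrier M" using C by blast
  qed (auto intro: submodule_zero submodule_add submodule_smult submoduleE(3))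
  then show ?thesis by (simp add: ideal_smult_def submodule_gen_def)
qed

lemma smult_in_ideal_smult: "c \<in> J \<Longrightarrow> x \<in> carrier M \<Longrightarrow> c \<odot>\<^bsub>M\<^esub> x \<in> ideal_smult R J M"
  unfolding ideal_smult_def submodule_gen_def by blast

lemma ideal_smult_least:
  assumes "submodule W R M" "\<And>c x. c \<in> J \<Longrightarrow> x \<in> carrier M \<Longrightarrow> c \<odot>\<^bsub>M\<^esub> x \<in> W"
  shows "ideal_smult R J M \<subseteq> W"
  using assms unfolding ideal_smult_def submodule_gen_def by blast

lemma ideal_smult_carrier: "ideal_smult R (carrier R) M = carrier M"
proof (rule equalityI)
  show "ideal_smult R (carrier R) M \<subseteq> carrier M" by (rule ideal_smult_least[OF carrier_is_submodule]) auto
  show "carrier M \<subseteq> ideal_smult R (carrier R) M"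
    using smult_in_ideal_smult[of \<one> "carrier R"] by force
qed

text \<open>Reduces statements about a generated ideal to its generators: if each generator carries
  K into W, so does the whole ideal.\<close>

lemma transporter_ideal:
  assumes W: "submodule W R M" and K: "K \<subseteq> carrier M"
  shows "ideal {c \<in> carrier R. \<forall>x\<in>K. c \<odot>\<^bsub>M\<^esub> x \<in> W} R" (is "ideal ?I R")
proof (rule idealI)
  have [simp]: "x \<in> K \<Longrightarrow> x \<in> carrier M" for x using K by blast
  show "ring R" by (rule R.ring_axioms)
  show "subgroup ?I (add_monoid R)"
  proof (rule R.add.subgroupI)
    show "?I \<noteq> {}" using submodule_zero[OF W] by (auto intro!: exI[of _ \<zero>])
  qed (use submoduleE(3)[OF W] submodule_add[OF W] in
        \<open>auto simp: a_inv_def[symmetric] smult_l_minus smult_l_distr\<close>)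
  fix c d assume "c \<in> ?I" "d \<in> carrier R"
  then show "d \<otimes> c \<in> ?I" "c \<otimes> d \<in> ?I"
    using submodule_smult[OF W, of d] by (auto simp: smult_assoc1 R.m_comm[of c d])
qed

lemma seq_ideal_ideal: "(\<And>j. j \<in> {1..i} \<Longrightarrow> b j \<in> carrier R) \<Longrightarrow> ideal (seq_ideal R b i) R"
  unfolding seq_ideal_def by (rule R.genideal_ideal) auto

text \<open>The b_j lie in the ideal transporting JM into the sum, hence so does q_i; conversely JM
  lies in the colon of q_i JM by each b_j. The factor \<open>J\<close> stands on the left to match
  the recursion of powers in the monoid of ideals.\<close>

lemma ideal_smult_seq_prod:
  assumes b: "\<And>j. j \<in> {1..i} \<Longrightarrow> b j \<in> carrier R" and J: "ideal J R"
  shows "ideal_smult R (J \<cdot> seq_ideal R b i) M = partial_sum b (ideal_smult R J M) i"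
proof -
  let ?q = "seq_ideal R b i" and ?K = "ideal_smult R J M"
  note q = seq_ideal_ideal[of i b, OF b]
  have qJ: "J \<cdot> ?q = ?q \<cdot> J" by (rule R.ideal_prod_commute[OF J q])
  have Jc: "J \<subseteq> carrier R" and qc: "?q \<subseteq> carrier R" using J q by (auto dest: ideal.Icarr)
  have K: "submodule ?K R M" by (rule ideal_smult_submodule[OF Jc])
  have prodc: "?q \<cdot> J \<subseteq> carrier R" by (rule R.ideal_prod_in_carrier[OF q J])
  have sP: "submodule (partial_sum b ?K i) R M" and sI: "submodule (ideal_smult R (?q \<cdot> J) M) R M"
    by (rule partial_sum_submodule[OF K b], assumption) (rule ideal_smult_submodule[OF prodc])
  show ?thesis unfolding qJ
  proof (rule equalityI)
    have "?q \<subseteq> {c \<in> carrier R. \<forall>x\<in>?K. c \<odot>\<^bsub>M\<^esub> x \<in> partial_sum b ?K i}"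
      unfolding seq_ideal_def
      using smult_in_partial_sum[of ?K i b, OF K b] b
      by (intro R.genideal_minimal transporter_ideal sP submoduleE(1)[OF K]) auto
    then have q_smult: "c \<odot>\<^bsub>M\<^esub> x \<in> partial_sum b ?K i" if "c \<in> ?q" "x \<in> ?K" for c x using that by blast
    show "ideal_smult R (?q \<cdot> J) M \<subseteq> partial_sum b ?K i"
    proof (rule ideal_smult_least[OF sP])
      fix c x assume c: "c \<in> ?q \<cdot> J" and x: "x \<in> carrier M"
      from c show "c \<odot>\<^bsub>M\<^esub> x \<in> partial_sum b ?K i"
      proof (induction c rule: ideal_prod.induct)
        case (prod c d)
        then have "(c \<otimes> d) \<odot>\<^bsub>M\<^esub> x = c \<odot>\<^bsub>M\<^esub> (d \<odot>\<^bsub>M\<^esub> x)" using qc Jc x by (intro smult_assoc1) auto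
        then show ?case using q_smult[OF prod(1) smult_in_ideal_smult[OF prod(2) x]] by simp
      next
        case (sum c d)
        then have "(c \<oplus> d) \<odot>\<^bsub>M\<^esub> x = c \<odot>\<^bsub>M\<^esub> x \<oplus>\<^bsub>M\<^esub> d \<odot>\<^bsub>M\<^esub> x"
          using prodc x by (intro smult_l_distr) auto
        then show ?case using submodule_add[OF sP sum(3,4)] by simp
      qed
    qed
    show "partial_sum b ?K i \<subseteq> ideal_smult R (?q \<cdot> J) M"
    proof (rule partial_sum_least[OF sI])
      fix j y assume j: "j \<in> {1..i}" and y: "y \<in> ?K"
      have bq: "b j \<in> ?q" unfolding seq_ideal_def using R.genideal_self[of "b ` {1..i}"] b j by blast
      have "?K \<subseteq> colon M (ideal_smult R (?q \<cdot> J) M) (b j)"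
      proof (rule ideal_smult_least[OF colon_submodule[OF sI b[OF j]]])
        fix c x assume c: "c \<in> J" and x: "x \<in> carrier M"
        have "b j \<odot>\<^bsub>M\<^esub> (c \<odot>\<^bsub>M\<^esub> x) = (b j \<otimes> c) \<odot>\<^bsub>M\<^esub> x"
          using smult_assoc1[OF b[OF j] _ x, of c] c Jc by auto
        also have "\<dots> \<in> ideal_smult R (?q \<cdot> J) M"
          by (intro smult_in_ideal_smult ideal_prod.prod bq c x)
        finally show "c \<odot>\<^bsub>M\<^esub> x \<in> colon M (ideal_smult R (?q \<cdot> J) M) (b j)"
          using c x Jc by (auto simp: colon_def)
      qed
      then show "b j \<odot>\<^bsub>M\<^esub> y \<in> ideal_smult R (?q \<cdot> J) M" using y by (auto simp: colon_def)
    qed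
  qed
qed

lemma ideal_smult_seq:
  assumes "\<And>j. j \<in> {1..i} \<Longrightarrow> b j \<in> carrier R"
  shows "ideal_smult R (seq_ideal R b i) M = partial_sum b (carrier M) i"
proof -
  have "carrier R \<cdot> seq_ideal R b i = seq_ideal R b i"
    using R.ideal_prod_commute[OF R.oneideal, of "seq_ideal R b i"] R.ideal_prod_one[of "seq_ideal R b i"]
      seq_ideal_ideal[of i b, OF assms] by simp
  then show ?thesis
    using ideal_smult_seq_prod[of i b, OF assms R.oneideal] ideal_smult_carrier by simp
qed

section \<open>Cosets and submodules of quotient modules\<close>

lemma abelian_subgroupI_submodule: "submodule N R M \<Longrightarrow> abelian_subgroup N M"
  by (rule abelian_subgroupI3) (auto simp: additive_subgroup_def submodule_def M.abelian_group_axioms)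

lemma coset_eq_iff:
  assumes "submodule N R M" "x \<in> carrier M" "y \<in> carrier M"
  shows "N +>\<^bsub>M\<^esub> x = N +>\<^bsub>M\<^esub> y \<longleftrightarrow> x \<ominus>\<^bsub>M\<^esub> y \<in> N"
proof -
  interpret abelian_subgroup N M by (rule abelian_subgroupI_submodule[OF assms(1)])
  show ?thesis
    using a_rcos_module[OF assms(3,2)] a_rcos_self[OF assms(2)] a_repr_independence'[OF _ assms(3)]
    by (auto simp: a_minus_def)
qed

lemma coset_eq_zero_iff:
  assumes "submodule N R M" "x \<in> carrier M"
  shows "N +>\<^bsub>M\<^esub> x = \<zero>\<^bsub>quot_module M N\<^esub> \<longleftrightarrow> x \<in> N"
proof -
  have "\<zero>\<^bsub>quot_module M N\<^esub> = N +>\<^bsub>M\<^esub> \<zero>\<^bsub>M\<^esub>"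
    using M.a_coset_add_zero[OF submoduleE(1)[OF assms(1)]] by (simp add: quot_module_def)
  then show ?thesis using coset_eq_iff[OF assms M.zero_closed] assms(2) minus_eq_iff[of x "\<zero>\<^bsub>M\<^esub>" x] by simp
qed

lemma quot_module_carrier: "carrier (quot_module M N) = (\<lambda>x. N +>\<^bsub>M\<^esub> x) ` carrier M"
  by (auto simp: quot_module_def A_RCOSETS_def')

lemma quot_module_add:
  assumes "submodule N R M" "x \<in> carrier M" "y \<in> carrier M"
  shows "(N +>\<^bsub>M\<^esub> x) \<oplus>\<^bsub>quot_module M N\<^esub> (N +>\<^bsub>M\<^esub> y) = N +>\<^bsub>M\<^esub> (x \<oplus>\<^bsub>M\<^esub> y)"
  using abelian_subgroup.a_rcos_sum[OF abelian_subgroupI_submodule[OF assms(1)] assms(2,3)]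
  by (simp add: quot_module_def)

lemma quot_module_smult_coset:
  assumes "submodule N R M" "c \<in> carrier R" "x \<in> carrier M"
  shows "c \<odot>\<^bsub>quot_module M N\<^esub> (N +>\<^bsub>M\<^esub> x) = N +>\<^bsub>M\<^esub> (c \<odot>\<^bsub>M\<^esub> x)"
  using quot_module_smult[OF module_axioms assms] .

text \<open>This lets the associated primes of M/N be recognised inside M.\<close>

lemma annihilator_coset:
  assumes "submodule N R M" "x \<in> carrier M"
  shows "annihilator R (quot_module M N) (N +>\<^bsub>M\<^esub> x) = {c \<in> carrier R. c \<odot>\<^bsub>M\<^esub> x \<in> N}"
  unfolding annihilator_def
  by (intro Collect_cong conj_cong refl) (simp add: assms quot_module_smult_coset coset_eq_zero_iff)

text \<open>The image of JM is a submodule containing all products from J and M/N, and the preimage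
  of J(M/N) is a submodule containing all products from J and M. Minimality gives both
  inclusions.\<close>

lemma ideal_smult_quot_module:
  assumes N: "submodule N R M" and J: "J \<subseteq> carrier R"
  shows "ideal_smult R J (quot_module M N) = (\<lambda>x. N +>\<^bsub>M\<^esub> x) ` ideal_smult R J M"
proof -
  let ?L = "quot_module M N" and ?p = "\<lambda>x. N +>\<^bsub>M\<^esub> x" and ?K = "ideal_smult R J M"
  interpret L: module R ?L by (rule quot_module_is_module[OF module_axioms N])
  note K = ideal_smult_submodule[OF J] and KL = L.ideal_smult_submodule[OF J]
  have Kc: "x \<in> ?K \<Longrightarrow> x \<in> carrier M" for x using K by (rule submodule_carrier)
  \<comment> \<open>Writing negation as multiplication by -1 reduces its closure property to that of
    scalars.\<close>
  have minus: "\<ominus>\<^bsub>?L\<^esub> C = (\<ominus>\<^bsub>R\<^esub> \<one>) \<odot>\<^bsub>?L\<^esub> C" if "C \<in> carrier ?L" for C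
    using that by (simp add: L.smult_l_minus)
  have image: "submodule (?p ` ?K) R ?L"
  proof (rule L.submoduleI)
    show "?p ` ?K \<subseteq> carrier ?L" using Kc by (auto simp: quot_module_carrier)
    have "\<zero>\<^bsub>?L\<^esub> = ?p \<zero>\<^bsub>M\<^esub>" using coset_eq_zero_iff[OF N M.zero_closed] submodule_zero[OF N] by simp
    then show "\<zero>\<^bsub>?L\<^esub> \<in> ?p ` ?K" using submodule_zero[OF K] by blast
    show smult: "c \<odot>\<^bsub>?L\<^esub> C \<in> ?p ` ?K" if "c \<in> carrier R" "C \<in> ?p ` ?K" for c C
      using that Kc submodule_smult[OF K] by (auto simp: quot_module_smult_coset[OF N])
    show "C \<oplus>\<^bsub>?L\<^esub> D \<in> ?p ` ?K" if "C \<in> ?p ` ?K" "D \<in> ?p ` ?K" for C D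
      using that Kc submodule_add[OF K] by (auto simp: quot_module_add[OF N])
    show "\<ominus>\<^bsub>?L\<^esub> C \<in> ?p ` ?K" if "C \<in> ?p ` ?K" for C
      using smult[of "\<ominus>\<^bsub>R\<^esub> \<one>" C] that Kc minus[of C] by (auto simp: quot_module_carrier)
  qed
  show ?thesis
  proof (rule equalityI)
    show "ideal_smult R J ?L \<subseteq> ?p ` ?K"
    proof (rule L.ideal_smult_least[OF image])
      fix c C assume c: "c \<in> J" and "C \<in> carrier ?L"
      then obtain x where "x \<in> carrier M" "C = ?p x" by (auto simp: quot_module_carrier)
      then show "c \<odot>\<^bsub>?L\<^esub> C \<in> ?p ` ?K"
        using quot_module_smult_coset[OF N, of c x] smult_in_ideal_smult[OF c] c J by auto
    qed
    have preimage: "submodule {x \<in> carrier M. ?p x \<in> ideal_smult R J ?L} R M" (is "submodule ?W R M")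
    proof (rule submoduleI)
      have "\<zero>\<^bsub>?L\<^esub> = ?p \<zero>\<^bsub>M\<^esub>" using coset_eq_zero_iff[OF N M.zero_closed] submodule_zero[OF N] by simp
      then show "\<zero>\<^bsub>M\<^esub> \<in> ?W" using L.submodule_zero[OF KL] by simp
      show smult: "c \<odot>\<^bsub>M\<^esub> x \<in> ?W" if "c \<in> carrier R" "x \<in> ?W" for c x
        using that L.submodule_smult[OF KL] by (auto simp: quot_module_smult_coset[OF N, symmetric])
      show "x \<oplus>\<^bsub>M\<^esub> y \<in> ?W" if "x \<in> ?W" "y \<in> ?W" for x y
        using that L.submodule_add[OF KL] by (auto simp: quot_module_add[OF N, symmetric])
      show "\<ominus>\<^bsub>M\<^esub> x \<in> ?W" if "x \<in> ?W" for x
        using smult[of "\<ominus>\<^bsub>R\<^esub> \<one>" x] that by (simp add: smult_l_minus)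
    qed auto
    have "?K \<subseteq> ?W"
    proof (rule ideal_smult_least[OF preimage])
      fix c x assume "c \<in> J" "x \<in> carrier M"
      then show "c \<odot>\<^bsub>M\<^esub> x \<in> ?W"
        using L.smult_in_ideal_smult[of c J "?p x"] J
        by (auto simp: quot_module_smult_coset[OF N] quot_module_carrier)
    qed
    then show "?p ` ?K \<subseteq> ideal_smult R J ?L" by blast
  qed
qed

text \<open>With P n = q^n M, the result on elements in
  \<open>relative_regular_imp_superficial\<close> is carried over to M/q_(i-1) M by cosets. The
  required equality is obtained for every n >= 1.\<close>

lemma absolutely_superficial_if_relative_regular:
  assumes b: "\<And>j. j \<in> {1..r} \<Longrightarrow> b j \<in> carrier R" and bm: "\<And>j. j \<in> {1..r} \<Longrightarrow> b j \<in> \<mm>"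
    and reg: "relative_regular_list {\<zero>\<^bsub>M\<^esub>} (map b [1..<Suc r])"
  shows "absolutely_superficial_seq R \<mm> M b r"
proof -
  define q where "q = seq_ideal R b r"
  define Q where "Q n = q [^]\<^bsub>ideals_set R\<^esub> n" for n :: nat
  define P where "P n = ideal_smult R (Q n) M" for n
  let ?S = "partial_sum b (carrier M)"
  interpret I: comm_monoid "ideals_set R" by (rule R.ideals_set_is_comm_monoid)
  have q: "ideal q R" unfolding q_def by (rule seq_ideal_ideal[of r b, OF b])
  \<comment> \<open>Powers in the monoid of ideals start at the unit ideal, which is the whole ring,
    and pick up the new factor on the right.\<close>
  have Q0: "Q 0 = carrier R" and QS: "Q (Suc n) = Q n \<cdot> q" for n
    by (simp_all add: Q_def I.nat_pow_Suc) (simp_all add: ideals_set_def)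
  have Q: "ideal (Q n) R" for n
    by (induction n) (auto simp: Q0 QS intro: R.oneideal R.ideal_prod_is_ideal q)
  have Qc: "Q n \<subseteq> carrier R" for n using Q by (auto dest: ideal.Icarr)
  have Q1: "Q 1 = q" using QS[of 0] R.ideal_prod_commute[OF R.oneideal q] R.ideal_prod_one[OF q] Q0 by simp
  have sP: "submodule (P n) R M" for n unfolding P_def by (rule ideal_smult_submodule[OF Qc])
  have P0: "P 0 = carrier M" by (simp add: P_def Q0 ideal_smult_carrier)
  have PS: "P (Suc n) = partial_sum b (P n) r" for n
    unfolding P_def QS q_def by (rule ideal_smult_seq_prod[of r b, OF b Q])
  have P1: "P 1 = ?S r" using PS[of 0] P0 by simp
  \<comment> \<open>An index shift: position i of the list holds b_(i+1), and its first i entries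
    generate q_i.\<close>
  have regS: "colon M (?S i) (b (Suc i)) \<inter> P 1 \<subseteq> ?S i" if "i < r" for i
  proof -
    let ?bs = "map b [1..<Suc r]"
    have "colon M (adjoin_list {\<zero>\<^bsub>M\<^esub>} (take i ?bs)) (?bs ! i) \<inter> adjoin_list {\<zero>\<^bsub>M\<^esub>} ?bs
        \<subseteq> adjoin_list {\<zero>\<^bsub>M\<^esub>} (take i ?bs)"
      using reg that unfolding relative_regular_list_def by (simp del: upt_Suc)
    moreover have "take i ?bs = map b [1..<Suc i]" "?bs ! i = b (Suc i)"
      using that by (simp_all add: take_map del: upt_Suc)
    ultimately show ?thesis by (simp only: P1 partial_sum_eq_adjoin_list)
  qed
  have superficial: "colon L (ideal_smult R (Q (n + 1)) L) (b i) \<inter> ideal_smult R q L = ideal_smult R (Q n) L"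
    if i: "i \<in> {1..r}" and L: "L = seq_quot R M b (i - 1)" and n: "1 \<le> n" for i L n
  proof -
    obtain i' where i': "i = Suc i'" "i' < r" using i by (cases i) auto
    let ?N = "?S i'"
    have bi: "b i \<in> carrier R" using b i by blast
    have N: "submodule ?N R M" using b i' by (intro partial_sum_submodule carrier_is_submodule) auto
    have LN: "L = quot_module M ?N" using b i' unfolding L seq_quot_def by (subst ideal_smult_seq) auto
    have im: "ideal_smult R (Q k) L = (\<lambda>x. ?N +>\<^bsub>M\<^esub> x) ` P k" for k
      unfolding LN P_def by (rule ideal_smult_quot_module[OF N Qc])
    have Pc: "x \<in> P k \<Longrightarrow> x \<in> carrier M" for x k using sP by (rule submodule_carrier)
    have Pn: "P n \<subseteq> P 1"
      using n PS[of "n - 1"] partial_sum_mono[of "P (n - 1)" "P 0" b r] PS[of 0] submoduleE(1)[OF sP] P0 by simp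
    have im1: "ideal_smult R q L = (\<lambda>x. ?N +>\<^bsub>M\<^esub> x) ` P 1" using im[of 1] Q1 by simp
    show ?thesis unfolding im im1
    proof (intro equalityI subsetI IntI)
      \<comment> \<open>Representatives are chosen with x in qM for C and y in q^(n+1) M for b_i C.
        Then x is replaced by some z in q^n M from the same coset.\<close>
      fix C assume "C \<in> colon L ((\<lambda>x. ?N +>\<^bsub>M\<^esub> x) ` P (n + 1)) (b i) \<inter> (\<lambda>x. ?N +>\<^bsub>M\<^esub> x) ` P 1"
      then obtain x y where x: "x \<in> P 1" "C = ?N +>\<^bsub>M\<^esub> x" and y: "y \<in> P (Suc n)" "b i \<odot>\<^bsub>L\<^esub> C = ?N +>\<^bsub>M\<^esub> y"
        by (auto simp: colon_def)
      have "?N +>\<^bsub>M\<^esub> (b i \<odot>\<^bsub>M\<^esub> x) = ?N +>\<^bsub>M\<^esub> y"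
        using y(2) quot_module_smult_coset[OF N bi Pc[OF x(1)]] unfolding LN x(2) by simp
      then have "b i \<odot>\<^bsub>M\<^esub> x \<ominus>\<^bsub>M\<^esub> y \<in> ?N"
        using coset_eq_iff[OF N _ Pc[OF y(1)]] Pc[OF x(1)] bi by simp
      then obtain z where z: "z \<in> P n" "x \<ominus>\<^bsub>M\<^esub> z \<in> ?N"
        using relative_regular_imp_superficial[OF b sP P0 PS regS i'(2) n x(1) y(1)] i' by auto
      then have "C = ?N +>\<^bsub>M\<^esub> z" using coset_eq_iff[OF N Pc[OF x(1)] Pc[OF z(1)]] x(2) by simp
      then show "C \<in> (\<lambda>x. ?N +>\<^bsub>M\<^esub> x) ` P n" using z by blast
    next
      fix C assume "C \<in> (\<lambda>x. ?N +>\<^bsub>M\<^esub> x) ` P n"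
      then obtain z where z: "z \<in> P n" "C = ?N +>\<^bsub>M\<^esub> z" by blast
      then show "C \<in> (\<lambda>x. ?N +>\<^bsub>M\<^esub> x) ` P 1" using Pn by blast
      \<comment> \<open>Since b_i is one of the generators of q, it carries q^n M into q^(n+1)
        M.\<close>
      have "b i \<odot>\<^bsub>M\<^esub> z \<in> P (Suc n)" unfolding PS by (rule smult_in_partial_sum[OF sP b i z(1)])
      moreover have "b i \<odot>\<^bsub>L\<^esub> C = ?N +>\<^bsub>M\<^esub> (b i \<odot>\<^bsub>M\<^esub> z)"
        using quot_module_smult_coset[OF N bi Pc[OF z(1)]] unfolding LN z(2) .
      moreover have "C \<in> carrier L" unfolding LN quot_module_carrier z(2) using Pc[OF z(1)] by blast
      ultimately show "C \<in> colon L ((\<lambda>x. ?N +>\<^bsub>M\<^esub> x) ` P (n + 1)) (b i)"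
        by (auto simp: colon_def)
    qed
  qed
  show ?thesis
    unfolding absolutely_superficial_seq_def Let_def q_def[symmetric] Q_def[symmetric]
  proof (intro conjI ballI bm)
    fix i assume "i \<in> {1..r}"
    then show "\<forall>\<^sub>F n in sequentially. colon (seq_quot R M b (i - 1))
        (ideal_smult R (Q (n + 1)) (seq_quot R M b (i - 1))) (b i) \<inter> ideal_smult R q (seq_quot R M b (i - 1))
        = ideal_smult R (Q n) (seq_quot R M b (i - 1))"
      using superficial eventually_ge_at_top[of 1] by (blast intro: eventually_mono)
  qed
qed

end

context fg_module
begin

text \<open>A prime consisting of all c with c x in N is the annihilator of the coset of x, hence
  associated to M/N. So the definition by associated primes supplies the avoidance needed for
  \<open>colon_le_saturation_if_avoids_Ass\<close>, with N = q_i M for the element a_(i+1).\<close>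

lemma filter_regular_list_if_filter_regular_seq:
  assumes I: "ideal I R" and a: "\<And>j. j \<in> {1..r} \<Longrightarrow> a j \<in> carrier R"
    and reg: "filter_regular_seq R \<mm> I M a r"
  shows "filter_regular_list I {\<zero>\<^bsub>M\<^esub>} (map a [1..<Suc r])"
  unfolding filter_regular_list_def
proof (intro allI impI)
  fix i assume "i < length (map a [1..<Suc r])"
  then have i: "i < r" by (simp del: upt_Suc)
  let ?N = "partial_sum a (carrier M) i"
  have N: "submodule ?N R M" using a i by (intro partial_sum_submodule carrier_is_submodule) auto
  have L: "seq_quot R M a i = quot_module M ?N"
    using a i unfolding seq_quot_def by (subst ideal_smult_seq) auto
  have "colon M ?N (a (Suc i)) \<subseteq> saturation I ?N"
  proof (rule colon_le_saturation_if_avoids_Ass[OF N])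
    show "I \<subseteq> carrier R" using I by (auto dest: ideal.Icarr)
    show "a (Suc i) \<in> carrier R" using a i by simp
    fix \<pp> x assume p: "primeideal \<pp> R" and x: "x \<in> carrier M" "\<pp> = {c \<in> carrier R. c \<odot>\<^bsub>M\<^esub> x \<in> ?N}"
      and "\<not> I \<subseteq> \<pp>"
    have "?N +>\<^bsub>M\<^esub> x \<in> carrier (seq_quot R M a i)" using x(1) unfolding L quot_module_carrier by blast
    moreover have "\<pp> = annihilator R (seq_quot R M a i) (?N +>\<^bsub>M\<^esub> x)"
      unfolding L annihilator_coset[OF N x(1)] by (rule x(2))
    ultimately have "\<pp> \<in> Ass R (seq_quot R M a i) - V R I"
      using p \<open>\<not> I \<subseteq> \<pp>\<close> unfolding Ass_def V_def by blast
    then show "a (Suc i) \<notin> \<pp>" using reg i unfolding filter_regular_seq_def by (force dest: bspec[of _ _ "Suc i"])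
  qed
  moreover have "take i (map a [1..<Suc r]) = map a [1..<Suc i]" using i by (simp add: take_map del: upt_Suc)
  moreover have "map a [1..<Suc r] ! i = a (Suc i)" using i by (simp del: upt_Suc)
  ultimately show "colon M (adjoin_list {\<zero>\<^bsub>M\<^esub>} (take i (map a [1..<Suc r]))) (map a [1..<Suc r] ! i)
      \<subseteq> saturation I (adjoin_list {\<zero>\<^bsub>M\<^esub>} (take i (map a [1..<Suc r])))"
    by (simp only: partial_sum_eq_adjoin_list)
qed

end

section \<open>Exponents for the given sequence\<close>

theorem proposition2p1:
  fixes A :: "('a, 'k) ring_scheme" and \<mm> \<aa> :: "'a set"
    and M :: "('a, 'b, 'l) module_scheme"
    and a :: "nat \<Rightarrow> 'a" and r n :: nat
  assumes "local_ring A \<mm>"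
    and "module A M" and "finitely_generated A M"
    and "ideal \<aa> A"
    and "\<forall>i\<in>{1..r}. a i \<in> \<mm>"
    and "filter_regular_seq A \<mm> \<aa> M a r"
    and "\<forall>i\<in>{1..r}. a i \<in> \<aa>"
  shows "\<exists>e :: nat \<Rightarrow> nat. (\<forall>i\<in>{1..r}. n \<le> e i) \<and> mono_on {1..r} e \<and>
    absolutely_superficial_seq A \<mm> M (\<lambda>i. a i [^]\<^bsub>A\<^esub> e i) r"
proof -
  interpret local_ring A \<mm> by fact
  interpret fg_module A M
    using assms(2,3) noetherian_ring_axioms by (simp add: fg_module_def fg_module_axioms_def)
  interpret m: maximalideal \<mm> A by (rule maximal)
  have \<aa>: "\<aa> \<subseteq> carrier A" using assms(4) by (auto dest: ideal.Icarr)
  have a: "a j \<in> carrier A" if "j \<in> {1..r}" for j using assms(7) \<aa> that by blast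
  let ?as = "map a [1..<Suc r]"
  have "filter_regular_list \<aa> {\<zero>\<^bsub>M\<^esub>} ?as"
    by (rule filter_regular_list_if_filter_regular_seq[OF assms(4) a assms(6)])
  moreover have "set ?as \<subseteq> \<aa>" using assms(7) by auto
  \<comment> \<open>The bound is max 1 n instead of n: an exponent 0 would produce 1, which is not
    in the maximal ideal.\<close>
  ultimately obtain es :: "nat list" where es: "length es = length ?as" "sorted es" "\<forall>e\<in>set es. max 1 n \<le> e"
    "relative_regular_list {\<zero>\<^bsub>M\<^esub>} (map2 ([^]\<^bsub>A\<^esub>) ?as es)"
    using exists_relative_regular_powers[OF submodule_zero_set \<aa>, of ?as "max 1 n"] by blast
  \<comment> \<open>The list counts from 0, the sequence from 1.\<close>
  define e where "e i = es ! (i - 1)" for i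
  have len: "length es = r" using es(1) by simp
  have e_ge: "max 1 n \<le> e i" if "i \<in> {1..r}" for i
    using es(3) that len unfolding e_def by (intro bspec[OF es(3)] nth_mem) auto
  have "mono_on {1..r} e"
    using es(2) len by (auto simp: mono_on_def e_def intro!: sorted_nth_mono)
  moreover have pow_m: "a i [^]\<^bsub>A\<^esub> e i \<in> \<mm>" if i: "i \<in> {1..r}" for i
  proof -
    obtain k where "e i = Suc k" using e_ge[OF i] by (cases "e i") auto
    then show ?thesis using assms(5) a[OF i] i by (auto intro: m.I_l_closed)
  qed
  moreover have "map2 ([^]\<^bsub>A\<^esub>) ?as es = map (\<lambda>i. a i [^]\<^bsub>A\<^esub> e i) [1..<Suc r]"
    using len by (intro nth_equalityI) (auto simp: e_def simp del: upt_Suc)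
  then have "absolutely_superficial_seq A \<mm> M (\<lambda>i. a i [^]\<^bsub>A\<^esub> e i) r"
    using es(4) a pow_m by (intro absolutely_superficial_if_relative_regular) auto
  ultimately show ?thesis using e_ge by (intro exI[of _ e]) auto
qed

end
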